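(* Let $\beta>0$. Let $m\to\infty$ and let $n=n_m$, $s=s_m$, $P=P_m$ depend on $m$. Assume that $s=O(1)$ and $\binom ms n^{-1}\to\beta$ as $m\to\infty$. Let $X_1$ have distribution $P$ and let $Z_{m1}=\binom{X_1}{s}\binom ms^{-1/2}n^{1/2}$. Assume that there is a random variable $Z$ such that $Z_{m1}$ converges in distribution to $Z$, $0<\mathbf E Z^2<\infty$, and $\lim_{m\to\infty}\mathbf E Z_{m1}^2=\mathbf E Z^2$. Let $\mu=\mathbf E Z$ and $$p_k=\frac1{k!}\,\mathbf E\bigl((Z\mu)^k e^{-Z\mu}\bigr),\qquad k=0,1,2,\dots.$$ Then for every $k=2,3,\dots$ we have, as $m\to\infty$, $$\alpha^{[k]}_s(m,P)=\frac1k\,\frac{\mathbf E Z}{\sqrt\beta}\,\frac{p_{k-1}}{p_k}+o(1).$$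
   Context: Active random intersection graph $G_s(n,m,P)$: let $W=\{w_1,\dots,w_m\}$, let $P$ be a probability distribution on $\{0,1,\dots,m\}$, and let $1\le s\le m$ be an integer. Let $D_1,\dots,D_n$ be independent identically distributed random subsets of $W$ with $\mathbf P(D_i=A)=P(|A|)\binom{m}{|A|}^{-1}$ for each $A\subset W$. The vertex set is $\{v_1,\dots,v_n\}$, and distinct vertices $v_i,v_j$ are adjacent ($v_i\sim v_j$) iff $|D_i\cap D_j|\ge s$. Let $d(v_1)$ denote the degree of $v_1$. As usual $\binom{x}{s}=0$ for integers $0\le x<s$. For an integer $k\ge2$, $\alpha^{[k]}_s(m,P)=\mathbf P\bigl(v_2\sim v_3\mid v_1\sim v_2,\ v_1\sim v_3,\ d(v_1)=k\bigr)$ in $G_s(n,m,P)$ (with $n=n_m$). *)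

theory Defs
  imports
    "HOL-Probability.Probability"
    "HOL-Library.Landau_Symbols"
begin

text \<open>
  A random subset of \<open>W = {1..m}\<close>: its size has distribution \<open>P\<close>, and given its size it is uniform.
  This is meaningful only if \<open>P\<close> is supported on \<open>{0..m}\<close>.
\<close>

definition random_subset :: "nat \<Rightarrow> nat pmf \<Rightarrow> nat set pmf" where
  "random_subset m P = bind_pmf P (\<lambda>x. pmf_of_set {A. A \<subseteq> {1..m} \<and> card A = x})"

lemma pmf_random_subset:
  assumes "set_pmf P \<subseteq> {0..m}"
  shows "pmf (random_subset m P) A =
    (if A \<subseteq> {1..m} then pmf P (card A) / real (m choose card A) else 0)"
proof -
  let ?S = "\<lambda>x. {A. A \<subseteq> {1..m} \<and> card A = x}"
  have fin: "finite (?S x)" for x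
    by (rule finite_subset[of _ "Pow {1..m}"]) auto
  have card: "card (?S x) = m choose x" for x
    using n_subsets[of "{1..m}" x] by simp
  have ne: "?S x \<noteq> {}" if "x \<le> m" for x
  proof
    assume "?S x = {}"
    then have "m choose x = 0" by (metis card card.empty)
    with that show False by simp
  qed
  have "pmf (random_subset m P) A = (\<integral>x. pmf (pmf_of_set (?S x)) A \<partial>measure_pmf P)"
    unfolding random_subset_def by (rule pmf_bind)
  also have "\<dots> = (\<integral>x. (if A \<subseteq> {1..m} then 1 / real (m choose card A) else 0)
      * indicator {card A} x \<partial>measure_pmf P)"
  proof (rule integral_cong_AE)
    show "AE x in measure_pmf P. pmf (pmf_of_set (?S x)) A =
        (if A \<subseteq> {1..m} then 1 / real (m choose card A) else 0) * indicator {card A} x"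
    proof (rule AE_pmfI)
      fix x assume "x \<in> set_pmf P"
      with assms have "x \<le> m" by auto
      then show "pmf (pmf_of_set (?S x)) A =
          (if A \<subseteq> {1..m} then 1 / real (m choose card A) else 0) * indicator {card A} x"
        using fin[of x] ne[of x] card[of x] by (auto simp: indicator_def)
    qed
  qed simp_all
  also have "\<dots> = (if A \<subseteq> {1..m} then pmf P (card A) / real (m choose card A) else 0)"
    by (simp add: pmf.rep_eq)
  finally show ?thesis .
qed

text \<open>
  The family \<open>D\<^sub>1, \<dots>, D\<^sub>n\<close> of independent attribute sets; vertex \<open>v\<^sub>i\<close> is represented by its
  index \<open>i \<in> {1..n}\<close>, and the family takes the dummy value \<open>{}\<close> at all other indices.
\<close>

definition attribute_sets :: "nat \<Rightarrow> nat \<Rightarrow> nat pmf \<Rightarrow> (nat \<Rightarrow> nat set) pmf" where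
  "attribute_sets n m P = Pi_pmf {1..n} {} (\<lambda>_. random_subset m P)"

definition adjacent :: "nat \<Rightarrow> nat \<Rightarrow> (nat \<Rightarrow> nat set) \<Rightarrow> nat \<Rightarrow> nat \<Rightarrow> bool" where
  "adjacent s n D i j \<longleftrightarrow>
     i \<in> {1..n} \<and> j \<in> {1..n} \<and> i \<noteq> j \<and> card (D i \<inter> D j) \<ge> s"

definition vertex_degree :: "nat \<Rightarrow> nat \<Rightarrow> (nat \<Rightarrow> nat set) \<Rightarrow> nat \<Rightarrow> nat" where
  "vertex_degree s n D i = card {j. adjacent s n D i j}"

definition clustering_coeff :: "nat \<Rightarrow> nat \<Rightarrow> nat \<Rightarrow> nat pmf \<Rightarrow> nat \<Rightarrow> real" where
  "clustering_coeff s n m P k =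
     \<P>(D in measure_pmf (attribute_sets n m P).
        adjacent s n D 2 3 \<bar>
        adjacent s n D 1 2 \<and> adjacent s n D 1 3 \<and> vertex_degree s n D 1 = k)"

definition Z_scaled :: "nat \<Rightarrow> nat \<Rightarrow> nat \<Rightarrow> nat \<Rightarrow> real" where
  "Z_scaled s n m x =
     real (x choose s) * real (m choose s) powr (- 1 / 2) * real n powr (1 / 2)"

definition mixed_poisson_prob :: "'a measure \<Rightarrow> ('a \<Rightarrow> real) \<Rightarrow> nat \<Rightarrow> real" where
  "mixed_poisson_prob M Z k =
     (let \<mu> = (\<integral>\<omega>. Z \<omega> \<partial>M) in
        1 / fact k * (\<integral>\<omega>. (Z \<omega> * \<mu>) ^ k * exp (- (Z \<omega> * \<mu>)) \<partial>M))"

end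

theory Submission
  imports Defs
begin

text \<open>
  Write \<open>N = binom m s\<close>. Since \<open>n / N\<close> converges and the second moments of \<open>Z\<^sub>m = binom X s * sqrt (n / N)\<close>
  are uniformly integrable, errors only have to be controlled for attribute sets of fixed
  sizes. Given \<open>D\<^sub>1 = A\<close>, the degree is binomial with parameter \<open>q A\<close>, and
  \<open>n * q A \<approx> z * \<mu>\<close>, where \<open>z\<close> is the value of \<open>Z\<^sub>m\<close> at \<open>A\<close>. Three sets of bounded
  size that meet pairwise in at least \<open>s\<close> elements typically share one \<open>s\<close>-subset: otherwise
  the third set meets the union of the other two in at least \<open>s + 1\<close> elements, which costs an
  extra factor \<open>N / binom m (s + 1) \<rightarrow> 0\<close>. Hence the triangle probability given \<open>A\<close>, times
  \<open>n\<^sup>2\<close>, is close to \<open>z * \<mu>\<^sup>2 / sqrt \<beta>\<close>. With the Poisson limit of the remaining degree,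
  numerator and denominator of the conditional probability, both times \<open>n\<^sup>2\<close>, tend to
  \<open>\<mu> / sqrt \<beta> * (k - 1) * p\<^bsub>k-1\<^esub>\<close> and \<open>k * (k - 1) * p\<^sub>k\<close>.
\<close>

section \<open>Poisson approximation of binomial weights\<close>

text \<open>As \<open>s\<close> is only bounded, it may vary with \<open>m\<close>, and then
  \<open>z m x\<close> need not converge even at a fixed size \<open>x\<close>. The intermediate
  results therefore say that a difference of two moving quantities tends to 0, with
  \<open>mean m\<close> in place of \<mu>; actual limits are taken only at the end, where weak
  convergence applies. The second moment is all the integrability at hand. Each error term thus gets
  two separate estimates: a sharp one at a fixed size, whose constants may be exponential in that
  size, and a crude one for all sizes, at most quadratic in \<open>z\<close>. For the triangle
  probability the crude estimate gives up the edge between vertices 2 and 3; the two edges at vertex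
  1 are independent given \<open>D 1\<close>.\<close>

definition poisson_weight :: "nat \<Rightarrow> real \<Rightarrow> real" where
  "poisson_weight j l = l ^ j / fact j * exp (- l)"

text \<open>A polynomial in \<open>q\<close>, so that the recursion over trials is plain algebra;
  \<open>binomial_weight_eq_pmf\<close> identifies it with the binomial distribution when
  \<open>q\<close> lies in [0, 1].\<close>

definition binomial_weight :: "nat \<Rightarrow> real \<Rightarrow> nat \<Rightarrow> real" where
  "binomial_weight N q j = real (N choose j) * q ^ j * (1 - q) ^ (N - j)"

lemma poisson_weight_nonneg: "0 \<le> l \<Longrightarrow> 0 \<le> poisson_weight j l"
  by (simp add: poisson_weight_def)

lemma poisson_weight_le_1:
  assumes "0 \<le> l" shows "poisson_weight j l \<le> 1"
proof -
  have "(\<Sum>n\<in>{j}. l ^ n /\<^sub>R fact n) \<le> (\<Sum>n. l ^ n /\<^sub>R fact n)"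
    using assms by (intro sum_le_suminf summable_exp_generic) auto
  then have "l ^ j / fact j \<le> exp l"
    by (simp add: exp_def divide_inverse mult.commute)
  then show ?thesis by (simp add: poisson_weight_def exp_minus field_simps)
qed

text \<open>A factor \<open>l\<close> in front of a weight raises the index by one. Applied once in
  the numerator and twice in the denominator, this shift leads from \<open>k - 2\<close> further
  neighbours to \<open>p_(k-1)\<close> and \<open>p_k\<close> and produces the factors
  \<open>k - 1\<close> and \<open>k * (k - 1)\<close>.\<close>

lemma poisson_weight_Suc: "l * poisson_weight j l = real (Suc j) * poisson_weight (Suc j) l"
  by (simp add: poisson_weight_def field_simps del: of_nat_Suc)

lemma has_derivative_poisson_weight_0:
  "(poisson_weight 0 has_real_derivative - poisson_weight 0 l) (at l)"
  unfolding poisson_weight_def by (auto intro!: derivative_eq_intros)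

lemma has_derivative_poisson_weight_Suc:
  "(poisson_weight (Suc j) has_real_derivative poisson_weight j l - poisson_weight (Suc j) l) (at l)"
proof -
  have "((\<lambda>l. l ^ Suc j / fact (Suc j) * exp (- l)) has_real_derivative
      real (Suc j) * l ^ j / fact (Suc j) * exp (- l) - l ^ Suc j / fact (Suc j) * exp (- l)) (at l)"
    by (rule derivative_eq_intros refl | simp add: field_simps del: of_nat_Suc fact_Suc power_Suc)+
  moreover have "real (Suc j) * l ^ j / fact (Suc j) = l ^ j / fact j"
    by (simp add: field_simps del: of_nat_Suc)
  ultimately show ?thesis by (simp add: poisson_weight_def[abs_def] del: of_nat_Suc fact_Suc power_Suc)
qed

text \<open>The derivative is minus a weight or a difference of two weights, all in [0, 1] on the
  nonnegative half-line, so its modulus there is at most 1.\<close>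

lemma poisson_weight_lipschitz:
  assumes "0 \<le> a" "0 \<le> b"
  shows "\<bar>poisson_weight j a - poisson_weight j b\<bar> \<le> \<bar>a - b\<bar>"
proof -
  have "\<exists>D. (poisson_weight j has_real_derivative D) (at l) \<and> \<bar>D\<bar> \<le> 1" if "0 \<le> l" for l
  proof (cases j)
    case 0
    then show ?thesis
      using has_derivative_poisson_weight_0[of l] poisson_weight_nonneg[OF that, of 0]
        poisson_weight_le_1[OF that, of 0]
      by (intro exI[of _ "- poisson_weight 0 l"]) auto
  next
    case (Suc i)
    have "\<bar>poisson_weight i l - poisson_weight (Suc i) l\<bar> \<le> 1"
      using poisson_weight_nonneg[OF that, of i] poisson_weight_nonneg[OF that, of "Suc i"]
        poisson_weight_le_1[OF that, of i] poisson_weight_le_1[OF that, of "Suc i"] by linarith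
    then show ?thesis using has_derivative_poisson_weight_Suc[of i l] Suc by blast
  qed
  then obtain D where D: "\<And>l. 0 \<le> l \<Longrightarrow> (poisson_weight j has_real_derivative D l) (at l) \<and> \<bar>D l\<bar> \<le> 1"
    by metis
  have "norm (poisson_weight j a - poisson_weight j b) \<le> 1 * norm (a - b)"
  proof (rule field_differentiable_bound[of "{0..}"])
    show "(poisson_weight j has_field_derivative D l) (at l within {0..})" if "l \<in> {0..}" for l
      using D[of l] that by (auto intro: has_field_derivative_at_within)
  qed (use D assms in auto)
  then show ?thesis by simp
qed

text \<open>First-order expansion: the mean value theorem yields the derivative at an intermediate
  point, and its Lipschitz bound costs a second factor \<open>q\<close>. The constant 2 arises
  because the derivative is a difference of two 1-Lipschitz weights.\<close>

lemma poisson_weight_shift: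
  assumes "0 \<le> l" "0 \<le> q"
    and D: "\<And>x. (poisson_weight j has_real_derivative D x) (at x)"
    and lip: "\<And>a b. 0 \<le> a \<Longrightarrow> 0 \<le> b \<Longrightarrow> \<bar>D a - D b\<bar> \<le> 2 * \<bar>a - b\<bar>"
  shows "\<bar>poisson_weight j (l + q) - (poisson_weight j l + q * D l)\<bar> \<le> 2 * q\<^sup>2"
proof (cases "q = 0")
  case False
  then have "l < l + q" using assms by simp
  from MVT2[OF this D] obtain z where z: "l < z" "z < l + q"
    "poisson_weight j (l + q) - poisson_weight j l = q * D z" by auto
  then have "\<bar>poisson_weight j (l + q) - (poisson_weight j l + q * D l)\<bar> = q * \<bar>D z - D l\<bar>"
  proof -
    have "poisson_weight j (l + q) - (poisson_weight j l + q * D l) = q * (D z - D l)"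
      using z(3) by (simp add: right_diff_distrib)
    then show ?thesis using assms(2) by (simp add: abs_mult)
  qed
  also have "\<dots> \<le> q * (2 * \<bar>z - l\<bar>)" using assms z by (intro mult_left_mono lip) auto
  also have "\<dots> \<le> q * (2 * q)" using assms z by (intro mult_left_mono) auto
  finally show ?thesis by (simp add: power2_eq_square)
qed simp

lemma binomial_weight_0: "binomial_weight (Suc N) q 0 = (1 - q) * binomial_weight N q 0"
  by (simp add: binomial_weight_def)

lemma binomial_weight_Suc:
  "binomial_weight (Suc N) q (Suc j) = q * binomial_weight N q j + (1 - q) * binomial_weight N q (Suc j)"
\<comment> \<open>For \<open>j \<ge> N\<close> truncated subtraction breaks the relation between the
  exponents \<open>N - j\<close> and \<open>N - Suc j\<close>, but then
  \<open>N choose Suc j\<close> is 0.\<close>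
proof (cases "Suc j \<le> N")
  case True
  then have "N - j = Suc (N - Suc j)" by simp
  then show ?thesis by (simp add: binomial_weight_def algebra_simps)
next
  case False
  then show ?thesis by (simp add: binomial_weight_def algebra_simps)
qed

text \<open>
  One Bernoulli step of the binomial recursion is, up to second order in \<open>q\<close>, the shift of the
  Poisson parameter from \<open>l\<close> to \<open>l + q\<close>.
\<close>

lemma binomial_weight_poisson:
  assumes "0 \<le> q" "q \<le> 1"
  shows "\<bar>binomial_weight N q j - poisson_weight j (real N * q)\<bar> \<le> 2 * real N * q\<^sup>2"
proof (induction N arbitrary: j)
  case 0
  then show ?case by (cases j) (auto simp: binomial_weight_def poisson_weight_def)
next
  case (Suc N)
  define l where "l = real N * q"
  have l: "0 \<le> l" using assms by (simp add: l_def)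
  have eq: "real (Suc N) * q = l + q" by (simp add: l_def algebra_simps)
  show ?case
  proof (cases j)
    case 0
    have s: "\<bar>poisson_weight 0 (l + q) - (poisson_weight 0 l + q * (- poisson_weight 0 l))\<bar> \<le> 2 * q\<^sup>2"
    proof (rule poisson_weight_shift[OF l assms(1) has_derivative_poisson_weight_0])
      fix a b :: real assume "0 \<le> a" "0 \<le> b"
      then have "\<bar>poisson_weight 0 b - poisson_weight 0 a\<bar> \<le> \<bar>a - b\<bar>"
        by (subst (2) abs_minus_commute) (rule poisson_weight_lipschitz)
      moreover have "\<bar>a - b\<bar> \<le> 2 * \<bar>a - b\<bar>" by simp
      ultimately have "\<bar>poisson_weight 0 b - poisson_weight 0 a\<bar> \<le> 2 * \<bar>a - b\<bar>"
        by (rule order_trans)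
      then show "\<bar>- poisson_weight 0 a - - poisson_weight 0 b\<bar> \<le> 2 * \<bar>a - b\<bar>" by simp
    qed
    have "\<bar>(1 - q) * (binomial_weight N q 0 - poisson_weight 0 l)\<bar> \<le> 1 * (2 * real N * q\<^sup>2)"
      unfolding abs_mult using Suc.IH[of 0] assms by (intro mult_mono) (auto simp: l_def)
    then show ?thesis unfolding 0 eq binomial_weight_0 using s
      by (simp add: algebra_simps)
  next
    case (Suc i)
    have s: "\<bar>poisson_weight (Suc i) (l + q) - (poisson_weight (Suc i) l + q * (poisson_weight i l - poisson_weight (Suc i) l))\<bar> \<le> 2 * q\<^sup>2"
    proof (rule poisson_weight_shift[OF l assms(1) has_derivative_poisson_weight_Suc])
      fix a b :: real assume "0 \<le> a" "0 \<le> b"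
      note lip = poisson_weight_lipschitz[OF this, of i] poisson_weight_lipschitz[OF this, of "Suc i"]
      have "\<bar>poisson_weight i a - poisson_weight (Suc i) a - (poisson_weight i b - poisson_weight (Suc i) b)\<bar>
          = \<bar>(poisson_weight i a - poisson_weight i b) - (poisson_weight (Suc i) a - poisson_weight (Suc i) b)\<bar>"
        by (simp add: algebra_simps)
      also have "\<dots> \<le> \<bar>a - b\<bar> + \<bar>a - b\<bar>"
        by (rule order_trans[OF abs_triangle_ineq4 add_mono[OF lip]])
      finally show "\<bar>poisson_weight i a - poisson_weight (Suc i) a - (poisson_weight i b - poisson_weight (Suc i) b)\<bar> \<le> 2 * \<bar>a - b\<bar>"
        by simp
    qed
    \<comment> \<open>The two inherited errors enter with weights \<open>1 - q\<close> and
      \<open>q\<close>, so together they cost no more than the old bound, and each further trial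
      adds only \<open>2 * q^2\<close>.\<close>
    have "\<bar>(1 - q) * (binomial_weight N q (Suc i) - poisson_weight (Suc i) l)\<bar> \<le> (1 - q) * (2 * real N * q\<^sup>2)"
      unfolding abs_mult using Suc.IH[of "Suc i"] assms by (intro mult_mono) (auto simp: l_def)
    moreover have "\<bar>q * (binomial_weight N q i - poisson_weight i l)\<bar> \<le> q * (2 * real N * q\<^sup>2)"
      unfolding abs_mult using Suc.IH[of i] assms by (intro mult_mono) (auto simp: l_def)
    ultimately show ?thesis unfolding Suc eq binomial_weight_Suc using s
      by (simp add: algebra_simps)
  qed
qed

text \<open>The target \<open>l m\<close> is bounded but may move. As \<open>n * q\<close> is
  bounded, the error \<open>2 * n * q^2\<close> is of order \<open>1 / n\<close>. The
  \<open>d\<close> missing trials stand for the vertices whose sets are already exposed; they shift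
  the parameter by \<open>d * q\<close>, again of order \<open>1 / n\<close>.\<close>

lemma tendsto_binomial_weight_poisson:
  fixes q l :: "nat \<Rightarrow> real" and n :: "nat \<Rightarrow> nat"
  assumes q: "\<And>m. 0 \<le> q m" "\<And>m. q m \<le> 1" and l: "\<And>m. 0 \<le> l m" "eventually (\<lambda>m. l m \<le> L) sequentially"
    and n: "filterlim n at_top sequentially"
    and lim: "(\<lambda>m. real (n m) * q m - l m) \<longlonglongrightarrow> 0"
  shows "(\<lambda>m. binomial_weight (n m - d) (q m) j - poisson_weight j (l m)) \<longlonglongrightarrow> 0"
proof -
  have n': "(\<lambda>m. 1 / real (n m)) \<longlonglongrightarrow> 0"
    using filterlim_compose[OF lim_1_over_n n] by simp
  have ev: "eventually (\<lambda>m. real (n m) * q m \<le> L + 1) sequentially"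
    using l(2) order_tendstoD(2)[OF lim zero_less_one] by eventually_elim linarith
  have n1: "eventually (\<lambda>m. n m \<ge> Suc d) sequentially"
    using n unfolding filterlim_at_top by blast
  have bound: "eventually (\<lambda>m. \<bar>binomial_weight (n m - d) (q m) j - poisson_weight j (l m)\<bar>
     \<le> 2 * (L+1)\<^sup>2 * (1 / real (n m)) + (real d * (L + 1) * (1 / real (n m)) + \<bar>real (n m) * q m - l m\<bar>)) sequentially"
    using ev n1
  proof eventually_elim
    case (elim m)
    have nz: "real (n m) \<noteq> 0" using elim(2) by simp
    have "\<bar>binomial_weight (n m - d) (q m) j - poisson_weight j (real (n m - d) * q m)\<bar> \<le> 2 * real (n m - d) * (q m)\<^sup>2"
      by (rule binomial_weight_poisson[OF q])
    also have "\<dots> \<le> 2 * real (n m) * (q m)\<^sup>2" by (intro mult_mono) auto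
    also have "\<dots> = 2 * (real (n m) * q m)\<^sup>2 * (1 / real (n m))" using nz by (simp add: power2_eq_square)
    also have "\<dots> \<le> 2 * (L+1)\<^sup>2 * (1 / real (n m))"
      using elim q by (intro mult_mono power_mono) auto
    finally have 1: "\<bar>binomial_weight (n m - d) (q m) j - poisson_weight j (real (n m - d) * q m)\<bar> \<le> 2 * (L+1)\<^sup>2 * (1 / real (n m))" .
    have "real d * q m = real d * (real (n m) * q m) * (1 / real (n m))" using nz by simp
    also have "\<dots> \<le> real d * (L+1) * (1 / real (n m))"
      by (rule mult_right_mono[OF mult_left_mono[OF elim(1)]]) simp_all
    finally have 2: "real d * q m \<le> real d * (L+1) * (1 / real (n m))" .
    have "\<bar>poisson_weight j (real (n m - d) * q m) - poisson_weight j (l m)\<bar> \<le> \<bar>real (n m - d) * q m - l m\<bar>"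
      using q l by (intro poisson_weight_lipschitz) auto
    also have "real (n m - d) * q m - l m = (real (n m) * q m - l m) - real d * q m"
      using elim(2) by (simp add: of_nat_diff left_diff_distrib)
    also have "\<bar>\<dots>\<bar> \<le> \<bar>real (n m) * q m - l m\<bar> + real d * q m"
      using q(1)[of m] abs_triangle_ineq4[of "real (n m) * q m - l m" "real d * q m"] by simp
    finally have "\<bar>poisson_weight j (real (n m - d) * q m) - poisson_weight j (l m)\<bar>
        \<le> real d * (L+1) * (1 / real (n m)) + \<bar>real (n m) * q m - l m\<bar>"
      using 2 by simp
    note 3 = add_mono[OF 1 this]
    show ?case
      using dist_triangle[of "binomial_weight (n m - d) (q m) j" "poisson_weight j (l m)"
          "poisson_weight j (real (n m - d) * q m)"]
      unfolding dist_real_def by (rule order_trans) (use 3 in \<open>simp only: add.assoc\<close>)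
  qed
  have "(\<lambda>m. 2 * (L+1)\<^sup>2 * (1 / real (n m)) + (real d * (L + 1) * (1 / real (n m)) + \<bar>real (n m) * q m - l m\<bar>)) \<longlonglongrightarrow> 2 * (L+1)\<^sup>2 * 0 + (real d * (L+1) * 0 + \<bar>0\<bar>)"
    by (intro tendsto_intros n' lim)
  then have lim0: "(\<lambda>m. 2 * (L+1)\<^sup>2 * (1 / real (n m)) + (real d * (L + 1) * (1 / real (n m)) + \<bar>real (n m) * q m - l m\<bar>)) \<longlonglongrightarrow> 0" by simp
  show ?thesis
    by (rule Lim_null_comparison[where g = "\<lambda>m. 2 * (L+1)\<^sup>2 * (1 / real (n m)) +
        (real d * (L + 1) * (1 / real (n m)) + \<bar>real (n m) * q m - l m\<bar>)"])
      (use bound lim0 in simp_all)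
qed

lemma binomial_weight_eq_pmf:
  "0 \<le> q \<Longrightarrow> q \<le> 1 \<Longrightarrow> binomial_weight N q j = pmf (binomial_pmf N q) j"
  unfolding binomial_weight_def by (rule pmf_binomial[symmetric])

lemma binomial_weight_bounds:
  assumes "0 \<le> q" "q \<le> 1"
  shows "0 \<le> binomial_weight N q j" "binomial_weight N q j \<le> 1"
  unfolding binomial_weight_eq_pmf[OF assms] by (rule pmf_nonneg pmf_le_1)+

section \<open>Intersections with uniform random subsets\<close>

text \<open>For \<open>y > m\<close> the underlying set is empty and \<open>pmf_of_set\<close>
  unspecified, hence the assumption \<open>y \<le> m\<close> in the lemmas about it.\<close>

definition uniform_subset :: "nat \<Rightarrow> nat \<Rightarrow> nat set pmf" where
  "uniform_subset m y = pmf_of_set {A. A \<subseteq> {1..m} \<and> card A = y}"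

text \<open>A real 0/1 value, so that joint events become products and enter expectations
  directly.\<close>

definition meets :: "nat \<Rightarrow> nat set \<Rightarrow> nat set \<Rightarrow> real" where
  "meets s A B = of_bool (s \<le> card (A \<inter> B))"

lemma finite_subsets_card: "finite {A. A \<subseteq> {1..m::nat} \<and> card A = y}"
  by (rule finite_subset[of _ "Pow {1..m}"]) auto

lemma subsets_card_nonempty: "y \<le> m \<Longrightarrow> {A. A \<subseteq> {1..m::nat} \<and> card A = y} \<noteq> {}"
proof -
  assume "y \<le> m"
  then have "card {A. A \<subseteq> {1..m} \<and> card A = y} \<noteq> 0"
    by (subst n_subsets) auto
  then show "{A. A \<subseteq> {1..m::nat} \<and> card A = y} \<noteq> {}" by (metis card.empty)
qed

lemma set_uniform_subset:
  "y \<le> m \<Longrightarrow> set_pmf (uniform_subset m y) = {A. A \<subseteq> {1..m} \<and> card A = y}"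
  unfolding uniform_subset_def
  using finite_subsets_card subsets_card_nonempty by (rule set_pmf_of_set[rotated])

lemma expectation_uniform_subset:
  fixes g :: "nat set \<Rightarrow> real"
  assumes "y \<le> m"
  shows "measure_pmf.expectation (uniform_subset m y) g =
    (\<Sum>A | A \<subseteq> {1..m} \<and> card A = y. g A) / real (m choose y)"
  unfolding uniform_subset_def
  using n_subsets[of "{1..m}" y]
  by (subst integral_pmf_of_set[OF subsets_card_nonempty[OF assms] finite_subsets_card]) simp

lemma choose_le_pow2: "n choose k \<le> 2 ^ n"
proof (cases "k \<le> n")
  case True
  then have "(\<Sum>i\<in>{k}. n choose i) \<le> (\<Sum>i\<le>n. n choose i)"
    by (intro sum_mono2) auto
  then show ?thesis by (simp add: choose_row_sum)
qed (simp add: binomial_eq_0)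

text \<open>Removing \<open>T\<close> is a bijection onto the subsets of the complement with
  \<open>y - card T\<close> elements. The case distinction guards against truncated subtraction: for
  \<open>card T > y\<close> the formula would read \<open>choose 0\<close> and give 1 instead of
  0.\<close>

lemma card_subsets_superset:
  assumes T: "T \<subseteq> {1..m::nat}"
  shows "card {B. B \<subseteq> {1..m} \<and> card B = y \<and> T \<subseteq> B} =
    (if card T \<le> y then (m - card T) choose (y - card T) else 0)"
proof -
  have fT: "finite T" using T finite_subset by blast
  show ?thesis
  proof (cases "card T \<le> y")
    case True
    have "bij_betw (\<lambda>C. C \<union> T) {C. C \<subseteq> {1..m} - T \<and> card C = y - card T}
        {B. B \<subseteq> {1..m} \<and> card B = y \<and> T \<subseteq> B}"
    proof (rule bij_betw_byWitness[where f' = "\<lambda>B. B - T"])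
      show "(\<lambda>C. C \<union> T) ` {C. C \<subseteq> {1..m} - T \<and> card C = y - card T}
          \<subseteq> {B. B \<subseteq> {1..m} \<and> card B = y \<and> T \<subseteq> B}"
      proof clarify
        fix C assume C: "C \<subseteq> {1..m} - T" "card C = y - card T"
        then have "finite C" "C \<inter> T = {}" using finite_subset by blast+
        then have "card (C \<union> T) = y" using C True fT by (simp add: card_Un_disjoint)
        then show "C \<union> T \<subseteq> {1..m} \<and> card (C \<union> T) = y \<and> T \<subseteq> C \<union> T" using C T by auto
      qed
      show "(\<lambda>B. B - T) ` {B. B \<subseteq> {1..m} \<and> card B = y \<and> T \<subseteq> B}
          \<subseteq> {C. C \<subseteq> {1..m} - T \<and> card C = y - card T}"
        using fT by (auto simp: card_Diff_subset)
    qed auto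
    then have "card {B. B \<subseteq> {1..m} \<and> card B = y \<and> T \<subseteq> B} =
        card {C. C \<subseteq> {1..m} - T \<and> card C = y - card T}"
      by (simp add: bij_betw_same_card)
    also have "\<dots> = card ({1..m} - T) choose (y - card T)"
      by (rule n_subsets) simp
    also have "card ({1..m} - T) = m - card T" using T fT by (simp add: card_Diff_subset)
    finally show ?thesis using True by simp
  next
    case False
    have "{B. B \<subseteq> {1..m} \<and> card B = y \<and> T \<subseteq> B} = {}"
    proof (rule equals0I, elim CollectE conjE)
      fix B assume "B \<subseteq> {1..m}" "card B = y" "T \<subseteq> B"
      then show False using False card_mono[of B T] finite_subset[of B "{1..m}"] by simp
    qed
    then show ?thesis using False by (simp only: if_False card.empty)
  qed
qed

text \<open>Counting nested pairs of subsets in two ways (\<open>choose_mult\<close>) rewrites the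
  hypergeometric quotient so that \<open>m\<close> occurs only in \<open>m choose card T\<close>,
  the scale of all later normalisations.\<close>

lemma expectation_contains:
  assumes "y \<le> m" "T \<subseteq> {1..m}"
  shows "measure_pmf.expectation (uniform_subset m y) (\<lambda>B. of_bool (T \<subseteq> B)) =
    real (y choose card T) / real (m choose card T)"
proof -
  let ?r = "card T"
  have r: "?r \<le> m" using card_mono[OF _ assms(2)] by simp
  have "(\<Sum>B | B \<subseteq> {1..m} \<and> card B = y. of_bool (T \<subseteq> B)) =
      real (card {B. B \<subseteq> {1..m} \<and> card B = y \<and> T \<subseteq> B})"
    using finite_subsets_card[of m y] by (simp add: of_bool_def sum.If_cases Int_def conj_assoc)
  also have "\<dots> / real (m choose y) = real (y choose ?r) / real (m choose ?r)"
  proof (cases "?r \<le> y")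
    case True
    then have "(m choose y) * (y choose ?r) = (m choose ?r) * ((m - ?r) choose (y - ?r))"
      using assms by (intro choose_mult)
    then have "real (m choose y) * real (y choose ?r) = real (m choose ?r) * real ((m - ?r) choose (y - ?r))"
      by (metis of_nat_mult)
    then show ?thesis using True assms(1) r unfolding card_subsets_superset[OF assms(2)]
      by (simp add: field_simps)
  next
    case False
    then show ?thesis unfolding card_subsets_superset[OF assms(2)] by (simp add: binomial_eq_0)
  qed
  finally show ?thesis by (simp add: expectation_uniform_subset[OF assms(1)])
qed

lemma integrable_uniform_subset [simp]:
  "y \<le> m \<Longrightarrow> integrable (measure_pmf (uniform_subset m y)) (g :: _ \<Rightarrow> real)"
  by (intro integrable_measure_pmf_finite) (simp add: set_uniform_subset finite_subsets_card[simplified])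

text \<open>The binomial coefficient counts the \<open>r\<close>-subsets of \<open>S\<close>
  contained in \<open>B\<close>, so linearity gives an exact mean. The probability of a large
  intersection is then bounded through it from both sides.\<close>

lemma expectation_choose_Int:
  assumes y: "y \<le> m" and S: "S \<subseteq> {1..m}"
  shows "measure_pmf.expectation (uniform_subset m y) (\<lambda>B. real (card (S \<inter> B) choose r)) =
    real (card S choose r) * real (y choose r) / real (m choose r)"
proof -
  have fS: "finite S" using S finite_subset by blast
  have eq: "real (card (S \<inter> B) choose r) = (\<Sum>T | T \<subseteq> S \<and> card T = r. of_bool (T \<subseteq> B))" for B
  proof -
    have "real (card (S \<inter> B) choose r) = real (card {T. T \<subseteq> S \<inter> B \<and> card T = r})"
      using fS by (subst n_subsets) auto
    also have "{T. T \<subseteq> S \<inter> B \<and> card T = r} = {T. T \<subseteq> S \<and> card T = r} \<inter> {T. T \<subseteq> B}" by auto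
    also have "real (card \<dots>) = (\<Sum>T | T \<subseteq> S \<and> card T = r. of_bool (T \<subseteq> B))"
      using fS by (subst sum_of_bool_eq) (auto intro: finite_subset[of _ "Pow S"])
    finally show ?thesis .
  qed
  have "measure_pmf.expectation (uniform_subset m y) (\<lambda>B. real (card (S \<inter> B) choose r)) =
      (\<Sum>T | T \<subseteq> S \<and> card T = r. measure_pmf.expectation (uniform_subset m y) (\<lambda>B. of_bool (T \<subseteq> B)))"
    unfolding eq by (intro Bochner_Integration.integral_sum) (simp add: y)
  also have "\<dots> = (\<Sum>T | T \<subseteq> S \<and> card T = r. real (y choose r) / real (m choose r))"
    using S y by (intro sum.cong refl) (auto simp: expectation_contains)
  also have "\<dots> = real (card S choose r) * real (y choose r) / real (m choose r)"
    using n_subsets[OF fS, of r] by simp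
  finally show ?thesis .
qed

lemma of_bool_le_choose: "of_bool (r \<le> j) \<le> real (j choose r)"
  by (cases "r \<le> j") (auto simp: Suc_leI)

text \<open>A crude Bonferroni inequality. For \<open>j = r\<close> it is an equality; for
  \<open>j > r\<close> the subtracted term is at least \<open>2 ^ x\<close>, which exceeds any
  binomial coefficient of \<open>j\<close>. The constant does no harm because the bound is only
  applied at fixed sizes.\<close>

lemma choose_le_of_bool:
  assumes "j \<le> x"
  shows "real (j choose r) - 2 ^ x * real (j choose Suc r) \<le> of_bool (r \<le> j)"
proof (cases "Suc r \<le> j")
  case True
  then have "1 \<le> real (j choose Suc r)" by (simp add: Suc_leI)
  moreover have "real (j choose r) \<le> 2 ^ x"
  proof -
    have "j choose r \<le> 2 ^ x" using choose_le_pow2[of j r] assms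
      by (meson le_trans one_le_numeral power_increasing)
    then show ?thesis by (metis of_nat_le_iff of_nat_numeral of_nat_power)
  qed
  ultimately have "real (j choose r) * 1 \<le> 2 ^ x * real (j choose Suc r)"
    by (intro mult_mono) auto
  then show ?thesis using True by simp
next
  case False
  then consider "j = r" | "j < r" by linarith
  then show ?thesis by cases (auto simp: binomial_eq_0)
qed

lemma meets_bounds: "0 \<le> meets s A B" "meets s A B \<le> 1"
  by (simp_all add: meets_def)

context
  fixes m x y :: nat and A :: "nat set"
  assumes A: "A \<subseteq> {1..m}" "card A = x" and y: "y \<le> m"
begin

text \<open>Markov's inequality for the number of common \<open>r\<close>-subsets. It has no
  size-dependent constant beyond the binomial coefficients themselves, so it also supplies the
  dominating bounds at large sizes.\<close>

lemma expectation_meets_le: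
  "measure_pmf.expectation (uniform_subset m y) (\<lambda>B. meets r A B) \<le>
    real (x choose r) * real (y choose r) / real (m choose r)"
  unfolding expectation_choose_Int[OF y A(1), of r, unfolded A(2), symmetric] meets_def
  using y by (intro integral_mono of_bool_le_choose) auto

lemma expectation_meets_ge:
  "real (x choose r) * real (y choose r) / real (m choose r)
    - 2 ^ x * (real (x choose Suc r) * real (y choose Suc r) / real (m choose Suc r)) \<le>
   measure_pmf.expectation (uniform_subset m y) (\<lambda>B. meets r A B)"
proof -
  have "finite A" using A finite_subset by blast
  then have le: "card (A \<inter> B) \<le> x" for B using A by (metis card_mono inf_le1)
  show ?thesis
    unfolding expectation_choose_Int[OF y A(1), unfolded A(2), symmetric] meets_def
    using y by (subst Bochner_Integration.integral_mult_right[symmetric], simp,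
        subst Bochner_Integration.integral_diff[symmetric], simp, simp)
      (intro integral_mono choose_le_of_bool le; simp)
qed

end

text \<open>Without a common \<open>s\<close>-subset, \<open>C\<close> meets \<open>A \<union> B\<close> in more than \<open>s\<close> elements.\<close>

lemma triangle_le:
  assumes "finite A" "finite B"
  shows "meets s A B * meets s A C * meets s B C \<le>
    meets s (A \<inter> B) C + meets s A B * meets (Suc s) (A \<union> B) C"
proof -
  have fin: "finite (A \<inter> C)" "finite (B \<inter> C)" using assms by auto
  \<comment> \<open>If \<open>A\<close> and \<open>B\<close> both meet \<open>C\<close> in
    \<open>s\<close> elements, the right side is at least \<open>2 * s\<close>; so when the triple
    intersection has fewer than \<open>s\<close> elements, the first summand exceeds
    \<open>s\<close>.\<close>
  have "card ((A \<union> B) \<inter> C) + card (A \<inter> B \<inter> C) = card (A \<inter> C) + card (B \<inter> C)"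
    using card_Un_Int[OF fin] by (simp add: Int_Un_distrib2 Int_ac Int_Un_distrib)
  then show ?thesis by (auto simp: meets_def)
qed

lemma triangle_ge:
  assumes "finite A" "finite B" "finite C"
  shows "meets s (A \<inter> B) C \<le> meets s A B * meets s A C * meets s B C"
proof -
  have "card (A \<inter> B \<inter> C) \<le> card (A \<inter> B)" "card (A \<inter> B \<inter> C) \<le> card (A \<inter> C)" "card (A \<inter> B \<inter> C) \<le> card (B \<inter> C)"
    using assms by (auto intro!: card_mono)
  then show ?thesis by (auto simp: meets_def)
qed

text \<open>With the first set and both other sizes fixed, only the positions are random; the
  distribution \<open>P\<close> enters later through an average over \<open>y\<close> and
  \<open>z\<close>.\<close>

definition triangle_prob :: "nat \<Rightarrow> nat \<Rightarrow> nat set \<Rightarrow> nat \<Rightarrow> nat \<Rightarrow> real" where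
  "triangle_prob m s A y z = measure_pmf.expectation (uniform_subset m y) (\<lambda>B.
     measure_pmf.expectation (uniform_subset m z) (\<lambda>C. meets s A B * meets s A C * meets s B C))"

lemma real_choose_le_pow2: "real (n choose k) \<le> 2 ^ n"
  by (metis choose_le_pow2 of_nat_le_iff of_nat_numeral of_nat_power)

lemma expectation_uniform_mono:
  fixes f g :: "nat set \<Rightarrow> real"
  assumes "y \<le> m" "\<And>B. B \<subseteq> {1..m} \<Longrightarrow> card B = y \<Longrightarrow> f B \<le> g B"
  shows "measure_pmf.expectation (uniform_subset m y) f \<le> measure_pmf.expectation (uniform_subset m y) g"
  using assms by (intro integral_mono_AE AE_pmfI) (auto simp: set_uniform_subset)

context
  fixes m x y :: nat and A :: "nat set"
  assumes A: "A \<subseteq> {1..m}" "card A = x" and y: "y \<le> m"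
begin

text \<open>The constant is generous: it only has to depend on the sizes and not on \<open>m\<close>
  or on the position of \<open>A\<close>, so that the error times \<open>n\<close> vanishes at fixed
  sizes.\<close>

lemma expectation_meets_approx:
  "\<bar>measure_pmf.expectation (uniform_subset m y) (\<lambda>B. meets s A B)
     - real (x choose s) * real (y choose s) / real (m choose s)\<bar>
   \<le> (2 ^ (x + y))\<^sup>2 / real (m choose Suc s)"
proof -
  have "2 ^ x * (real (x choose Suc s) * real (y choose Suc s) / real (m choose Suc s))
      = (2 ^ x * (real (x choose Suc s) * real (y choose Suc s))) / real (m choose Suc s)" by simp
  also have "\<dots> \<le> (2 ^ (x + y) * (2 ^ x * 2 ^ y)) / real (m choose Suc s)"
    by (intro divide_right_mono mult_mono real_choose_le_pow2 power_increasing) auto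
  also have "\<dots> = (2 ^ (x + y))\<^sup>2 / real (m choose Suc s)"
    by (simp add: power2_eq_square power_add)
  finally have "2 ^ x * (real (x choose Suc s) * real (y choose Suc s) / real (m choose Suc s))
     \<le> (2 ^ (x + y))\<^sup>2 / real (m choose Suc s)" .
  moreover have "0 \<le> (2 ^ (x + y))\<^sup>2 / real (m choose Suc s)" by simp
  ultimately show ?thesis
    using expectation_meets_le[OF A y, of s] expectation_meets_ge[OF A y, of s]
    unfolding abs_le_iff by linarith
qed

context
  fixes z :: nat assumes z: "z \<le> m"
begin

lemma card_Int_le: "card (A \<inter> B) \<le> x"
  using A by (metis card_mono finite_atLeastAtMost finite_subset inf_le1)

text \<open>The first-moment bound for \<open>C\<close> against the target
  \<open>A \<inter> B\<close> leaves a binomial coefficient of \<open>card (A \<inter> B)\<close>,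
  whose mean over \<open>B\<close> is known exactly. Each of the two steps contributes one factor
  \<open>1 / (m choose s)\<close>.\<close>

lemma expectation_meets_Int_le:
  "measure_pmf.expectation (uniform_subset m y) (\<lambda>B.
     measure_pmf.expectation (uniform_subset m z) (\<lambda>C. meets s (A \<inter> B) C))
   \<le> real (x choose s) * real (y choose s) * real (z choose s) / (real (m choose s))\<^sup>2"
proof -
  have "measure_pmf.expectation (uniform_subset m y) (\<lambda>B.
     measure_pmf.expectation (uniform_subset m z) (\<lambda>C. meets s (A \<inter> B) C))
    \<le> measure_pmf.expectation (uniform_subset m y) (\<lambda>B.
      real (card (A \<inter> B) choose s) * (real (z choose s) / real (m choose s)))"
    using expectation_meets_le[OF _ refl z, of "A \<inter> _" s] A
    by (intro expectation_uniform_mono[OF y]) (auto intro: order_trans)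
  also have "\<dots> = real (x choose s) * real (y choose s) * real (z choose s) / (real (m choose s))\<^sup>2"
    by (simp add: expectation_choose_Int[OF y A(1)] A(2) power2_eq_square del: times_divide_eq_right) simp
  finally show ?thesis .
qed

lemma expectation_meets_Int_ge:
  "real (x choose s) * real (y choose s) * real (z choose s) / (real (m choose s))\<^sup>2
   - 2 ^ x * (real (x choose Suc s) * real (y choose Suc s) * real (z choose Suc s) / (real (m choose Suc s))\<^sup>2)
   \<le> measure_pmf.expectation (uniform_subset m y) (\<lambda>B.
     measure_pmf.expectation (uniform_subset m z) (\<lambda>C. meets s (A \<inter> B) C))"
proof -
  let ?f = "\<lambda>r B. real (card (A \<inter> B) choose r) * (real (z choose r) / real (m choose r))"
  have E: "measure_pmf.expectation (uniform_subset m y) (?f r) =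
      real (x choose r) * real (y choose r) * real (z choose r) / (real (m choose r))\<^sup>2" for r
    by (simp add: expectation_choose_Int[OF y A(1)] A(2) power2_eq_square del: times_divide_eq_right) simp
  have "?f s B - 2 ^ x * ?f (Suc s) B \<le>
      measure_pmf.expectation (uniform_subset m z) (\<lambda>C. meets s (A \<inter> B) C)" for B
  proof -
    have "2 ^ card (A \<inter> B) * ?f (Suc s) B \<le> 2 ^ x * ?f (Suc s) B"
      by (intro mult_right_mono power_increasing card_Int_le) auto
    moreover have "?f s B - 2 ^ card (A \<inter> B) * ?f (Suc s) B \<le>
      measure_pmf.expectation (uniform_subset m z) (\<lambda>C. meets s (A \<inter> B) C)"
      using expectation_meets_ge[OF _ refl z, of "A \<inter> B" s] A by (auto simp: le_infI1)
    ultimately show ?thesis by linarith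
  qed
  then have "measure_pmf.expectation (uniform_subset m y) (\<lambda>B. ?f s B - 2 ^ x * ?f (Suc s) B)
      \<le> measure_pmf.expectation (uniform_subset m y) (\<lambda>B.
     measure_pmf.expectation (uniform_subset m z) (\<lambda>C. meets s (A \<inter> B) C))"
    by (intro expectation_uniform_mono[OF y])
  also have "measure_pmf.expectation (uniform_subset m y) (\<lambda>B. ?f s B - 2 ^ x * ?f (Suc s) B) =
     measure_pmf.expectation (uniform_subset m y) (?f s) - 2 ^ x * measure_pmf.expectation (uniform_subset m y) (?f (Suc s))"
    using y by (subst Bochner_Integration.integral_diff) simp_all
  finally show ?thesis unfolding E .
qed

lemma triangle_prob_nonneg: "0 \<le> triangle_prob m s A y z"
  unfolding triangle_prob_def by (intro Bochner_Integration.integral_nonneg mult_nonneg_nonneg meets_bounds)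

text \<open>Dropping the edge between \<open>B\<close> and \<open>C\<close> leaves two independent
  events. The resulting bound is the one used for domination over all sizes.\<close>

lemma triangle_prob_le_prod:
  "triangle_prob m s A y z \<le> (real (x choose s) * real (y choose s) / real (m choose s)) *
     (real (x choose s) * real (z choose s) / real (m choose s))"
proof -
  have "triangle_prob m s A y z \<le> measure_pmf.expectation (uniform_subset m y) (\<lambda>B.
     measure_pmf.expectation (uniform_subset m z) (\<lambda>C. meets s A B * meets s A C))"
    unfolding triangle_prob_def
    by (intro expectation_uniform_mono y z) (auto simp: meets_def)
  also have "\<dots> = measure_pmf.expectation (uniform_subset m y) (meets s A) *
      measure_pmf.expectation (uniform_subset m z) (meets s A)"
    by simp
  also have "\<dots> \<le> (real (x choose s) * real (y choose s) / real (m choose s)) *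
     (real (x choose s) * real (z choose s) / real (m choose s))"
    using expectation_meets_le[OF A y, of s] expectation_meets_le[OF A z, of s]
    by (intro mult_mono Bochner_Integration.integral_nonneg meets_bounds) auto
  finally show ?thesis .
qed

text \<open>A triangle in which \<open>C\<close> does not meet \<open>A \<inter> B\<close> in
  \<open>s\<close> elements pays twice: \<open>B\<close> meets \<open>A\<close>, of order
  \<open>1 / (m choose s)\<close>, and \<open>C\<close> meets \<open>A \<union> B\<close> in
  \<open>s + 1\<close> elements, of order \<open>1 / (m choose Suc s)\<close>. Keeping both factors
  is essential, since the error will be multiplied by \<open>n^2\<close>.\<close>

lemma triangle_prob_le:
  "triangle_prob m s A y z \<le> real (x choose s) * real (y choose s) * real (z choose s) / (real (m choose s))\<^sup>2
    + (2 ^ (x + y + z))\<^sup>2 / (real (m choose s) * real (m choose Suc s))"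
proof -
  let ?U = "measure_pmf.expectation (uniform_subset m y)" and ?V = "measure_pmf.expectation (uniform_subset m z)"
  let ?k = "2 ^ (x + y) * 2 ^ z / real (m choose Suc s)"
  have fA: "finite A" using A finite_subset by blast
  have "triangle_prob m s A y z \<le> ?U (\<lambda>B. ?V (\<lambda>C. meets s (A \<inter> B) C) + meets s A B * ?k)"
    unfolding triangle_prob_def
  proof (rule expectation_uniform_mono[OF y])
    fix B assume B: "B \<subseteq> {1..m}" "card B = y"
    then have fB: "finite B" using finite_subset by blast
    have "?V (\<lambda>C. meets s A B * meets s A C * meets s B C) \<le>
        ?V (\<lambda>C. meets s (A \<inter> B) C + meets s A B * meets (Suc s) (A \<union> B) C)"
      by (intro expectation_uniform_mono[OF z] triangle_le fA fB)
    also have "\<dots> = ?V (\<lambda>C. meets s (A \<inter> B) C) + meets s A B * ?V (\<lambda>C. meets (Suc s) (A \<union> B) C)"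
      using z by (subst Bochner_Integration.integral_add) simp_all
    also have "?V (\<lambda>C. meets (Suc s) (A \<union> B) C) \<le> ?k"
    proof -
      have "?V (\<lambda>C. meets (Suc s) (A \<union> B) C) \<le>
          real (card (A \<union> B) choose Suc s) * real (z choose Suc s) / real (m choose Suc s)"
        using A B by (intro expectation_meets_le z) auto
      also have "\<dots> \<le> 2 ^ card (A \<union> B) * 2 ^ z / real (m choose Suc s)"
        by (intro divide_right_mono mult_mono real_choose_le_pow2) auto
      also have "\<dots> \<le> ?k"
        using card_Un_le[of A B] A B by (intro divide_right_mono mult_right_mono power_increasing) auto
      finally show ?thesis .
    qed
    finally show "?V (\<lambda>C. meets s A B * meets s A C * meets s B C) \<le> ?V (\<lambda>C. meets s (A \<inter> B) C) + meets s A B * ?k"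
      by (simp add: mult_left_mono meets_bounds)
  qed
  also have "\<dots> = ?U (\<lambda>B. ?V (\<lambda>C. meets s (A \<inter> B) C)) + ?U (meets s A) * ?k"
    using y by (subst Bochner_Integration.integral_add) (simp_all del: times_divide_eq_right)
  also have "?U (meets s A) * ?k \<le> (2 ^ x * 2 ^ y / real (m choose s)) * ?k"
  proof (intro mult_right_mono)
    have "?U (meets s A) \<le> real (x choose s) * real (y choose s) / real (m choose s)"
      by (rule expectation_meets_le[OF A y])
    also have "\<dots> \<le> 2 ^ x * 2 ^ y / real (m choose s)"
      by (intro divide_right_mono mult_mono real_choose_le_pow2) auto
    finally show "?U (meets s A) \<le> 2 ^ x * 2 ^ y / real (m choose s)" .
  qed simp
  also have "(2 ^ x * 2 ^ y / real (m choose s)) * ?k = 2 ^ (x + y) * 2 ^ (x + y + z) / (real (m choose s) * real (m choose Suc s))"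
    by (simp add: power_add)
  also have "\<dots> \<le> 2 ^ (x + y + z) * 2 ^ (x + y + z) / (real (m choose s) * real (m choose Suc s))"
    by (intro divide_right_mono mult_right_mono power_increasing) auto
  also have "\<dots> = (2 ^ (x + y + z))\<^sup>2 / (real (m choose s) * real (m choose Suc s))"
    by (simp add: power2_eq_square)
  finally show ?thesis using expectation_meets_Int_le[of s] by simp
qed

text \<open>A common \<open>s\<close>-subset already forces all three edges, so the only loss is the
  second Bonferroni term for \<open>C\<close> meeting \<open>A \<inter> B\<close>.\<close>

lemma triangle_prob_ge:
  "real (x choose s) * real (y choose s) * real (z choose s) / (real (m choose s))\<^sup>2
    - (2 ^ (x + y + z))\<^sup>2 / (real (m choose Suc s))\<^sup>2 \<le> triangle_prob m s A y z"
proof -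
  have "2 ^ x * (real (x choose Suc s) * real (y choose Suc s) * real (z choose Suc s) / (real (m choose Suc s))\<^sup>2)
      = 2 ^ x * (real (x choose Suc s) * real (y choose Suc s) * real (z choose Suc s)) / (real (m choose Suc s))\<^sup>2" by simp
  also have "\<dots> \<le> 2 ^ (x + y + z) * (2 ^ x * 2 ^ y * 2 ^ z) / (real (m choose Suc s))\<^sup>2"
    by (intro divide_right_mono mult_mono real_choose_le_pow2 power_increasing) auto
  also have "\<dots> = (2 ^ (x + y + z))\<^sup>2 / (real (m choose Suc s))\<^sup>2"
    by (simp add: power2_eq_square power_add)
  finally have 1: "2 ^ x * (real (x choose Suc s) * real (y choose Suc s) * real (z choose Suc s) / (real (m choose Suc s))\<^sup>2)
     \<le> (2 ^ (x + y + z))\<^sup>2 / (real (m choose Suc s))\<^sup>2" .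
  have "measure_pmf.expectation (uniform_subset m y) (\<lambda>B.
     measure_pmf.expectation (uniform_subset m z) (\<lambda>C. meets s (A \<inter> B) C)) \<le> triangle_prob m s A y z"
    unfolding triangle_prob_def using A
    by (intro expectation_uniform_mono y z triangle_ge) (auto intro: finite_subset)
  with 1 expectation_meets_Int_ge[of s] show ?thesis by linarith
qed

lemma triangle_prob_approx:
  "\<bar>triangle_prob m s A y z - real (x choose s) * real (y choose s) * real (z choose s) / (real (m choose s))\<^sup>2\<bar>
    \<le> (2 ^ (x + y + z))\<^sup>2 / (real (m choose Suc s))\<^sup>2
      + (2 ^ (x + y + z))\<^sup>2 / (real (m choose s) * real (m choose Suc s))"
proof -
  have "0 \<le> (2 ^ (x + y + z))\<^sup>2 / (real (m choose Suc s))\<^sup>2"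
    "0 \<le> (2 ^ (x + y + z))\<^sup>2 / (real (m choose s) * real (m choose Suc s))" by simp_all
  with triangle_prob_le[of s] triangle_prob_ge[of s] show ?thesis
    unfolding abs_le_iff by linarith
qed

end

end

section \<open>Averaging over random sizes\<close>

lemma expectation_bind_pmf_finite:
  fixes h :: "'b \<Rightarrow> real"
  assumes "finite (set_pmf p)" "\<And>x. x \<in> set_pmf p \<Longrightarrow> finite (set_pmf (f x))"
  shows "measure_pmf.expectation (bind_pmf p f) h =
    measure_pmf.expectation p (\<lambda>x. measure_pmf.expectation (f x) h)"
  using assms by (simp add: pmf_expectation_bind[of "set_pmf p"] integral_measure_pmf[of "set_pmf p"])

lemma expectation_swap_finite:
  fixes h :: "'a \<Rightarrow> 'b \<Rightarrow> real"
  assumes "finite (set_pmf p)" "finite (set_pmf q)"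
  shows "measure_pmf.expectation p (\<lambda>x. measure_pmf.expectation q (\<lambda>y. h x y)) =
    measure_pmf.expectation q (\<lambda>y. measure_pmf.expectation p (\<lambda>x. h x y))"
  by (simp add: integral_measure_pmf[OF assms(1)] integral_measure_pmf[OF assms(2)] sum_distrib_left
      mult.left_commute sum.swap[of _ "set_pmf p"])

context
  fixes m :: nat and P :: "nat pmf"
  assumes P: "set_pmf P \<subseteq> {0..m}"
begin

lemma finite_set_pmf_P: "finite (set_pmf P)"
  using P finite_subset by blast

lemma random_subset_eq_bind: "random_subset m P = bind_pmf P (uniform_subset m)"
  by (simp add: random_subset_def uniform_subset_def[abs_def])

lemma finite_set_uniform: "y \<in> set_pmf P \<Longrightarrow> finite (set_pmf (uniform_subset m y))"
  using P finite_subsets_card by (subst set_uniform_subset) auto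

lemma set_random_subset: "set_pmf (random_subset m P) \<subseteq> Pow {1..m}"
  using P by (auto simp: random_subset_eq_bind set_uniform_subset subset_iff)

lemma finite_set_random_subset: "finite (set_pmf (random_subset m P))"
  using set_random_subset finite_subset by blast

lemma expectation_random_subset:
  "measure_pmf.expectation (random_subset m P) (g :: _ \<Rightarrow> real) =
   measure_pmf.expectation P (\<lambda>y. measure_pmf.expectation (uniform_subset m y) g)"
  unfolding random_subset_eq_bind
  by (rule expectation_bind_pmf_finite[OF finite_set_pmf_P finite_set_uniform])

lemma expectation_random_subset_card:
  "measure_pmf.expectation (random_subset m P) (\<lambda>A. g (card A)) = measure_pmf.expectation P (g :: _ \<Rightarrow> real)"
  unfolding expectation_random_subset
proof (intro integral_cong_AE AE_pmfI)
  fix y assume "y \<in> set_pmf P"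
  then have y: "y \<le> m" using P by auto
  have "measure_pmf.expectation (uniform_subset m y) (\<lambda>A. g (card A)) =
      measure_pmf.expectation (uniform_subset m y) (\<lambda>A. g y)"
    using y by (intro integral_cong_AE AE_pmfI) (auto simp: set_uniform_subset)
  then show "measure_pmf.expectation (uniform_subset m y) (\<lambda>A. g (card A)) = g y" by simp
qed auto

text \<open>The natural order of averaging is size of \<open>B\<close>, then \<open>B\<close>, size
  of \<open>C\<close>, then \<open>C\<close>. One exchange of finite sums moves both sizes to the
  outside, where \<open>triangle_prob\<close> is the inner average.\<close>

lemma expectation_triangle:
  "measure_pmf.expectation (random_subset m P) (\<lambda>B. measure_pmf.expectation (random_subset m P)
     (\<lambda>C. meets s A B * meets s A C * meets s B C)) =
   measure_pmf.expectation P (\<lambda>y. measure_pmf.expectation P (\<lambda>z. triangle_prob m s A y z))"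
  unfolding expectation_random_subset triangle_prob_def
  by (intro integral_cong_AE AE_pmfI expectation_swap_finite finite_set_uniform finite_set_pmf_P) auto

end

section \<open>The conditional probability as a ratio of expectations\<close>

lemma measure_pmf_eq_expectation:
  "measure_pmf.prob p S = measure_pmf.expectation p (\<lambda>x. of_bool (x \<in> S))"
proof -
  have "measure_pmf.prob p S = measure_pmf.expectation p (indicator S)" by simp
  then show ?thesis by (simp only: indicator_def[abs_def])
qed

lemma map_pmf_eq_bernoulli:
  fixes \<phi> :: "'a \<Rightarrow> bool"
  shows "map_pmf \<phi> p = bernoulli_pmf (measure_pmf.expectation p (\<lambda>x. of_bool (\<phi> x)))"
proof -
  have eq: "measure_pmf.expectation p (\<lambda>x. of_bool (\<phi> x)) = pmf (map_pmf \<phi> p) True"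
    by (simp add: pmf_map measure_pmf_eq_expectation vimage_def)
  have "pmf (map_pmf \<phi> p) False + pmf (map_pmf \<phi> p) True = 1"
  proof -
    have "(\<Sum>b\<in>{False, True}. pmf (map_pmf \<phi> p) b) = 1"
      by (rule sum_pmf_eq_1) auto
    then show ?thesis by simp
  qed
  then show ?thesis
    unfolding eq
    by (intro pmf_eqI) (case_tac i; simp add: pmf_le_1)
qed

text \<open>Applying \<phi> coordinatewise turns the product into independent Bernoulli trials. The
  default value \<open>d\<close> becomes \<open>\<phi> d\<close>, which is only taken outside
  \<open>J\<close>.\<close>

lemma count_pmf_eq_binomial:
  fixes \<phi> :: "'b \<Rightarrow> bool"
  assumes "finite J"
  shows "map_pmf (\<lambda>f. card {j \<in> J. \<phi> (f j)}) (Pi_pmf J d (\<lambda>_. p)) =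
    binomial_pmf (card J) (measure_pmf.expectation p (\<lambda>x. of_bool (\<phi> x)))"
proof -
  let ?q = "measure_pmf.expectation p (\<lambda>x. of_bool (\<phi> x) :: real)"
  have "?q \<in> {0..1}"
    using measure_pmf.prob_le_1[of p "{x. \<phi> x}"]
    by (auto simp: measure_pmf_eq_expectation)
  then have "binomial_pmf (card J) ?q = map_pmf (\<lambda>f. card {j \<in> J. f j}) (Pi_pmf J (\<phi> d) (\<lambda>_. bernoulli_pmf ?q))"
    by (rule binomial_pmf_altdef'[OF assms refl])
  also have "Pi_pmf J (\<phi> d) (\<lambda>_. bernoulli_pmf ?q) = map_pmf (\<lambda>h. \<phi> \<circ> h) (Pi_pmf J d (\<lambda>_. p))"
    unfolding map_pmf_eq_bernoulli[symmetric] by (rule Pi_pmf_map[OF assms refl])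
  finally show ?thesis by (simp add: map_pmf_comp o_def)
qed

text \<open>The \<open>q A\<close> of the overview: the success probability of the binomial degree
  given \<open>D 1 = A\<close>.\<close>

definition link_prob :: "nat \<Rightarrow> nat \<Rightarrow> nat pmf \<Rightarrow> nat set \<Rightarrow> real" where
  "link_prob s m P A = measure_pmf.expectation (random_subset m P) (meets s A)"

lemma link_prob_bounds: "0 \<le> link_prob s m P A" "link_prob s m P A \<le> 1"
proof -
  show "0 \<le> link_prob s m P A"
    unfolding link_prob_def by (intro Bochner_Integration.integral_nonneg meets_bounds)
  have "link_prob s m P A = measure_pmf.prob (random_subset m P) {B. s \<le> card (A \<inter> B)}"
    by (simp add: link_prob_def meets_def[abs_def] measure_pmf_eq_expectation)
  then show "link_prob s m P A \<le> 1" by simp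
qed

lemma attribute_sets_eq_bind:
  assumes "3 \<le> n"
  shows "attribute_sets n m P = do {
     A \<leftarrow> random_subset m P; B \<leftarrow> random_subset m P; C \<leftarrow> random_subset m P;
     f \<leftarrow> Pi_pmf {4..n} {} (\<lambda>_. random_subset m P);
     return_pmf (f(3 := C, 2 := B, 1 := A))}"
proof -
  have "{1..n} = insert 1 (insert 2 (insert 3 {4..n}))" using assms by auto
  then show ?thesis
    unfolding attribute_sets_def
    by (simp add: Pi_pmf_insert' bind_assoc_pmf bind_return_pmf)
qed

text \<open>Vertices 2 and 3 account for two of the \<open>k\<close> neighbours, which leaves
  \<open>k - 2\<close> among \<open>{4..n}\<close>; \<open>2 \<le> k\<close> makes this subtraction
  exact.\<close>

lemma degree_event_iff:
  assumes "3 \<le> n" "2 \<le> k" and D: "D = f(3 := C, 2 := B, 1 := A)"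
  shows "adjacent s n D 1 2 \<and> adjacent s n D 1 3 \<and> vertex_degree s n D 1 = k \<longleftrightarrow>
    s \<le> card (A \<inter> B) \<and> s \<le> card (A \<inter> C) \<and> card {j \<in> {4..n}. s \<le> card (A \<inter> f j)} = k - 2"
proof -
  have adj: "adjacent s n D 1 2 \<longleftrightarrow> s \<le> card (A \<inter> B)" "adjacent s n D 1 3 \<longleftrightarrow> s \<le> card (A \<inter> C)"
    using assms by (auto simp: adjacent_def)
  show ?thesis
  proof (cases "s \<le> card (A \<inter> B) \<and> s \<le> card (A \<inter> C)")
    case True
    have "{j. adjacent s n D 1 j} = insert 2 (insert 3 {j \<in> {4..n}. s \<le> card (A \<inter> f j)})" (is "?L = ?R")
    proof (rule set_eqI)
      fix j :: nat
      consider "j = 0" | "j = 1" | "j = 2" | "j = 3" | "4 \<le> j" by linarith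
      then show "j \<in> ?L \<longleftrightarrow> j \<in> ?R"
        by cases (use True assms in \<open>auto simp: adjacent_def\<close>)
    qed
    then have "vertex_degree s n D 1 = 2 + card {j \<in> {4..n}. s \<le> card (A \<inter> f j)}"
      by (simp add: vertex_degree_def)
    with True adj assms(2) show ?thesis by auto
  next
    case False
    then show ?thesis using adj by auto
  qed
qed

context
  fixes m :: nat and P :: "nat pmf"
  assumes P: "set_pmf P \<subseteq> {0..m}"
begin

text \<open>\<open>Q\<close> stays open so that one computation serves twice: adjacency of vertices
  2 and 3 gives the numerator, \<open>True\<close> the denominator. Given \<open>D 1 = A\<close> the
  other sets are independent, so the binomial factor, which does not involve \<open>B\<close> and
  \<open>C\<close>, splits off.\<close>

lemma prob_degree_event:
  assumes n: "3 \<le> n" and k: "2 \<le> k"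
  shows "measure_pmf.prob (attribute_sets n m P)
      {D. Q (D 2) (D 3) \<and> adjacent s n D 1 2 \<and> adjacent s n D 1 3 \<and> vertex_degree s n D 1 = k} =
    measure_pmf.expectation (random_subset m P) (\<lambda>A.
      measure_pmf.expectation (random_subset m P) (\<lambda>B. measure_pmf.expectation (random_subset m P) (\<lambda>C.
        meets s A B * meets s A C * of_bool (Q B C)))
      * binomial_weight (n - 3) (link_prob s m P A) (k - 2))"
proof -
  let ?R = "random_subset m P" and ?Pi = "Pi_pmf {4..n} {} (\<lambda>_. random_subset m P)"
  let ?S = "{D. Q (D 2) (D 3) \<and> adjacent s n D 1 2 \<and> adjacent s n D 1 3 \<and> vertex_degree s n D 1 = k}"
  note finR = finite_set_random_subset[OF P]
  have finPi: "finite (set_pmf ?Pi)" by (auto simp: set_Pi_pmf finR)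
  have "measure_pmf.expectation ?Pi (\<lambda>f. of_bool (f(3 := C, 2 := B, 1 := A) \<in> ?S)) =
     meets s A B * meets s A C * of_bool (Q B C) * binomial_weight (n - 3) (link_prob s m P A) (k - 2)"
    (is "?lhs = _") for A B C
  proof -
    have "of_bool (f(3 := C, 2 := B, 1 := A) \<in> ?S) = meets s A B * meets s A C * of_bool (Q B C) *
       of_bool (f \<in> (\<lambda>f. card {j \<in> {4..n}. s \<le> card (A \<inter> f j)}) -` {k - 2})" for f
      unfolding mem_Collect_eq degree_event_iff[OF n k refl] by (auto simp: meets_def)
    then have "?lhs = meets s A B * meets s A C * of_bool (Q B C) *
        measure_pmf.prob ?Pi ((\<lambda>f. card {j \<in> {4..n}. s \<le> card (A \<inter> f j)}) -` {k - 2})"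
      by (simp only: measure_pmf_eq_expectation) simp
    also have "measure_pmf.prob ?Pi ((\<lambda>f. card {j \<in> {4..n}. s \<le> card (A \<inter> f j)}) -` {k - 2}) =
        pmf (map_pmf (\<lambda>f. card {j \<in> {4..n}. s \<le> card (A \<inter> f j)}) ?Pi) (k - 2)"
      by (simp add: pmf_map)
    also have "map_pmf (\<lambda>f. card {j \<in> {4..n}. s \<le> card (A \<inter> f j)}) ?Pi = binomial_pmf (n - 3) (link_prob s m P A)"
      using n by (subst count_pmf_eq_binomial) (simp_all add: link_prob_def meets_def[abs_def])
    finally show ?thesis by (simp only: binomial_weight_eq_pmf[OF link_prob_bounds])
  qed
  note inner = this
  have "measure_pmf.prob (attribute_sets n m P) ?S =
     measure_pmf.expectation ?R (\<lambda>A. measure_pmf.expectation ?R (\<lambda>B. measure_pmf.expectation ?R (\<lambda>C.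
       measure_pmf.expectation ?Pi (\<lambda>f. of_bool (f(3 := C, 2 := B, 1 := A) \<in> ?S)))))"
    unfolding measure_pmf_eq_expectation attribute_sets_eq_bind[OF n]
    by (simp add: expectation_bind_pmf_finite finR finPi del: mem_Collect_eq)
  then show ?thesis unfolding inner by simp
qed

lemma expectation_meets_prod:
  "measure_pmf.expectation (random_subset m P) (\<lambda>B. measure_pmf.expectation (random_subset m P) (\<lambda>C.
        meets s A B * meets s A C)) = (link_prob s m P A)\<^sup>2"
  by (simp add: link_prob_def power2_eq_square)

lemma clustering_coeff_eq:
  assumes n: "3 \<le> n" and k: "2 \<le> k"
  shows "clustering_coeff s n m P k =
    measure_pmf.expectation (random_subset m P) (\<lambda>A.
      measure_pmf.expectation P (\<lambda>y. measure_pmf.expectation P (\<lambda>z. triangle_prob m s A y z))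
      * binomial_weight (n - 3) (link_prob s m P A) (k - 2)) /
    measure_pmf.expectation (random_subset m P) (\<lambda>A.
      (link_prob s m P A)\<^sup>2 * binomial_weight (n - 3) (link_prob s m P A) (k - 2))"
proof -
  have adj23: "adjacent s n D 2 3 \<longleftrightarrow> s \<le> card (D 2 \<inter> D 3)" for D
    using n by (auto simp: adjacent_def)
  have "clustering_coeff s n m P k =
     measure_pmf.prob (attribute_sets n m P)
      {D. s \<le> card (D 2 \<inter> D 3) \<and> adjacent s n D 1 2 \<and> adjacent s n D 1 3 \<and> vertex_degree s n D 1 = k} /
     measure_pmf.prob (attribute_sets n m P)
      {D. True \<and> adjacent s n D 1 2 \<and> adjacent s n D 1 3 \<and> vertex_degree s n D 1 = k}"
    unfolding clustering_coeff_def cond_prob_def adj23 by (simp add: conj_ac)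
  also have "\<dots> = measure_pmf.expectation (random_subset m P) (\<lambda>A.
      measure_pmf.expectation (random_subset m P) (\<lambda>B. measure_pmf.expectation (random_subset m P) (\<lambda>C.
        meets s A B * meets s A C * meets s B C))
      * binomial_weight (n - 3) (link_prob s m P A) (k - 2)) /
    measure_pmf.expectation (random_subset m P) (\<lambda>A.
      (link_prob s m P A)\<^sup>2 * binomial_weight (n - 3) (link_prob s m P A) (k - 2))"
    unfolding prob_degree_event[OF n k, of "\<lambda>B C. s \<le> card (B \<inter> C)"] prob_degree_event[OF n k, of "\<lambda>_ _. True"]
      meets_def[of s "_ :: nat set", symmetric]
    by (simp only: of_bool_eq mult_1_right expectation_meets_prod meets_def[symmetric])
  finally show ?thesis unfolding expectation_triangle[OF P] .
qed

end

section \<open>Uniform integrability\<close>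

text \<open>Growth in \<open>x\<close> that is uniform over \<open>s\<close> between 1 and
  \<open>S\<close>, from \<open>(x / s) ^ s \<le> x choose s\<close>. It serves both for
  \<open>N\<close> tending to infinity and for the tail bound at large sizes.\<close>

lemma choose_ge_over:
  assumes "1 \<le> s" "s \<le> S" "s \<le> x"
  shows "real x / real S \<le> real (x choose s)"
proof -
  have "real x / real S \<le> real x / real s" using assms by (intro divide_left_mono) auto
  also have "\<dots> = (real x / real s) ^ 1" by simp
  also have "\<dots> \<le> (real x / real s) ^ s" using assms by (intro power_increasing) auto
  also have "\<dots> \<le> real (x choose s)" by (rule binomial_ge_n_over_k_pow_k[OF assms(3)])
  finally show ?thesis .
qed

locale intersection_graph_seq =
  fixes \<beta> :: real
    and n s :: "nat \<Rightarrow> nat"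
    and P :: "nat \<Rightarrow> nat pmf"
    and M :: "'a measure"
    and Z :: "'a \<Rightarrow> real"
  assumes beta_pos: "\<beta> > 0"
    and s_range: "\<And>m. m \<ge> 1 \<Longrightarrow> 1 \<le> s m \<and> s m \<le> m"
    and P_range: "\<And>m. m \<ge> 1 \<Longrightarrow> set_pmf (P m) \<subseteq> {0..m}"
    and s_bigo: "(\<lambda>m. real (s m)) \<in> O(\<lambda>_. 1)"
    and ratio_lim: "(\<lambda>m. real (m choose s m) / real (n m)) \<longlonglongrightarrow> \<beta>"
    and prob_M: "prob_space M"
    and Z_meas: "Z \<in> borel_measurable M"
    and weak: "weak_conv_m (\<lambda>m. distr (measure_pmf (P m)) borel (Z_scaled (s m) (n m) m))
           (distr M borel Z)"
    and Z2_int: "integrable M (\<lambda>\<omega>. (Z \<omega>)\<^sup>2)"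
    and Z2_pos: "0 < (\<integral>\<omega>. (Z \<omega>)\<^sup>2 \<partial>M)"
    and Z2_lim: "(\<lambda>m. \<integral>x. (Z_scaled (s m) (n m) m x)\<^sup>2 \<partial>measure_pmf (P m))
           \<longlonglongrightarrow> (\<integral>\<omega>. (Z \<omega>)\<^sup>2 \<partial>M)"
begin

sublocale M: prob_space M by (rule prob_M)

declare Z_meas [measurable]

abbreviation E where "E m \<equiv> measure_pmf.expectation (P m)"
abbreviation z where "z m \<equiv> Z_scaled (s m) (n m) m"
definition N where "N m = real (m choose s m)"
definition N' where "N' m = real (m choose Suc (s m))"
definition r where "r m = real (n m) / N m"
definition mean where "mean m = E m (z m)"
definition \<mu> where "\<mu> = (\<integral>\<omega>. Z \<omega> \<partial>M)"

lemma integrable_P [simp]: "m \<ge> 1 \<Longrightarrow> integrable (measure_pmf (P m)) (f :: nat \<Rightarrow> real)"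
  by (intro integrable_measure_pmf_finite finite_set_pmf_P[OF P_range])

lemma expectation_P_mono:
  fixes f g :: "nat \<Rightarrow> real"
  assumes "m \<ge> 1" "\<And>x. x \<le> m \<Longrightarrow> f x \<le> g x"
  shows "E m f \<le> E m g"
proof (intro integral_mono_AE AE_pmfI)
  fix x assume "x \<in> set_pmf (P m)"
  then have "x \<le> m" using P_range[OF assms(1)] by auto
  then show "f x \<le> g x" by (rule assms(2))
qed (use assms(1) in auto)

section \<open>Growth of the binomial coefficients and of the number of vertices\<close>

lemma s_bounded: obtains S where "S \<ge> 1" "eventually (\<lambda>m. s m \<le> S) sequentially"
proof -
  from s_bigo obtain c where c: "eventually (\<lambda>m. norm (real (s m)) \<le> c * norm (1::real)) sequentially"
    by (elim landau_o.bigE)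
  show ?thesis
  proof (rule that[of "Suc (nat \<lceil>c\<rceil>)"])
    show "eventually (\<lambda>m. s m \<le> Suc (nat \<lceil>c\<rceil>)) sequentially"
      using c by eventually_elim (simp, linarith)
  qed simp
qed

lemma ev_ge_1: "eventually (\<lambda>m::nat. m \<ge> 1) sequentially"
  by (rule eventually_ge_at_top)

lemma N_pos: "m \<ge> 1 \<Longrightarrow> N m > 0"
  using s_range[of m] by (simp add: N_def)

lemma r_nonneg: "0 \<le> r m" by (simp add: r_def N_def)

lemma r_lim: "r \<longlonglongrightarrow> 1 / \<beta>"
proof -
  have "(\<lambda>m. inverse (real (m choose s m) / real (n m))) \<longlonglongrightarrow> inverse \<beta>"
    using ratio_lim beta_pos by (intro tendsto_inverse) auto
  then show ?thesis by (simp add: r_def[abs_def] N_def inverse_eq_divide)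
qed

lemma sqrt_r_lim: "(\<lambda>m. sqrt (r m)) \<longlonglongrightarrow> 1 / sqrt \<beta>"
  using tendsto_real_sqrt[OF r_lim] by (simp add: real_sqrt_divide)

lemma N_at_top: "filterlim N at_top sequentially"
proof -
  obtain S where S: "S \<ge> 1" "eventually (\<lambda>m. s m \<le> S) sequentially" by (rule s_bounded)
  have "filterlim (\<lambda>m. real m * (1 / real S)) at_top sequentially"
    using S by (intro filterlim_at_top_mult_tendsto_pos[OF tendsto_const] filterlim_real_sequentially) auto
  then show ?thesis
  proof (rule filterlim_at_top_mono)
    show "eventually (\<lambda>m. real m * (1 / real S) \<le> N m) sequentially"
      using S(2) ev_ge_1
    proof eventually_elim
      case (elim m)
      then show ?case using s_range[of m] choose_ge_over[of "s m" S m] by (simp add: N_def)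
    qed
  qed
qed

lemma n_at_top: "filterlim n at_top sequentially"
proof -
  have "filterlim (\<lambda>m. r m * N m) at_top sequentially"
    using beta_pos by (intro filterlim_tendsto_pos_mult_at_top[OF r_lim _ N_at_top]) simp
  moreover have "eventually (\<lambda>m. r m * N m = real (n m)) sequentially"
    using ev_ge_1 by eventually_elim (simp add: r_def N_pos[THEN less_imp_neq, symmetric])
  ultimately have "filterlim (\<lambda>m. real (n m)) at_top sequentially"
    by (simp cong: filterlim_cong)
  then have "filterlim (\<lambda>m. nat \<lfloor>real (n m)\<rfloor>) at_top sequentially"
    by (intro filterlim_compose[OF filterlim_nat_sequentially] filterlim_compose[OF filterlim_floor_sequentially])
  then show ?thesis by simp
qed

text \<open>By absorption, \<open>N / N'\<close> equals \<open>(s + 1) / (m - s)\<close>, which is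
  of order \<open>1 / m\<close> because \<open>s\<close> is bounded.\<close>

lemma N'_bound: obtains S where "S \<ge> 1" "eventually (\<lambda>m. 0 < N' m \<and> N m / N' m \<le> real S * (1 / (real m - real S))) sequentially"
proof -
  obtain S where S: "S \<ge> 1" "eventually (\<lambda>m. s m \<le> S) sequentially" by (rule s_bounded)
  show ?thesis
  proof (rule that[of "Suc S"])
    show "eventually (\<lambda>m. 0 < N' m \<and> N m / N' m \<le> real (Suc S) * (1 / (real m - real (Suc S)))) sequentially"
      using S(2) eventually_gt_at_top[of "Suc S"]
    proof eventually_elim
      case (elim m)
      have "Suc (s m) * (m choose Suc (s m)) = (m - s m) * (m choose s m)"
        by (simp only: binomial_absorption binomial_absorb_comp)
      then have "real (Suc (s m)) * N' m = real (m - s m) * N m"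
        unfolding N_def N'_def by (simp only: of_nat_mult[symmetric])
      also have "real (m - s m) = real m - real (s m)" using elim by (intro of_nat_diff) simp
      finally have eq: "real (Suc (s m)) * N' m = (real m - real (s m)) * N m" .
      have pos: "0 < N' m" using elim by (simp add: N'_def)
      have "N m / N' m = real (Suc (s m)) / (real m - real (s m))"
        using eq pos elim by (simp add: frac_eq_eq mult.commute del: of_nat_Suc)
      also have "\<dots> \<le> real (Suc S) / (real m - real (Suc S))"
        using elim by (intro frac_le) auto
      finally show ?case using pos by simp
    qed
  qed simp
qed

lemma N_over_N'_lim: "(\<lambda>m. N m / N' m) \<longlonglongrightarrow> 0"
proof -
  obtain S where S: "S \<ge> 1" "eventually (\<lambda>m. 0 < N' m \<and> N m / N' m \<le> real S * (1 / (real m - real S))) sequentially"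
    by (rule N'_bound)
  have lim: "(\<lambda>m. real S * (1 / (real m - real S))) \<longlonglongrightarrow> 0" 
  proof -
    have "filterlim (\<lambda>m. real m - real S) at_top sequentially"
      using filterlim_tendsto_add_at_top[OF tendsto_const[of "- real S"] filterlim_real_sequentially] by simp
    from tendsto_mult[OF tendsto_const[of "real S"] tendsto_divide_0[OF tendsto_const[of 1] filterlim_at_top_imp_at_infinity[OF this]]]
    show ?thesis by simp
  qed
  show ?thesis
  proof (rule Lim_null_comparison[OF _ lim])
    show "eventually (\<lambda>m. norm (N m / N' m) \<le> real S * (1 / (real m - real S))) sequentially"
      using S(2) ev_ge_1 by eventually_elim (simp add: N_pos less_imp_le)
  qed
qed

lemma n_over_N'_lim: "(\<lambda>m. real (n m) / N' m) \<longlonglongrightarrow> 0"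
proof -
  have "(\<lambda>m. r m * (N m / N' m)) \<longlonglongrightarrow> 0"
    using tendsto_mult[OF r_lim N_over_N'_lim] by simp
  moreover have "eventually (\<lambda>m. r m * (N m / N' m) = real (n m) / N' m) sequentially"
    using ev_ge_1 by eventually_elim (simp add: r_def N_pos[THEN less_imp_neq, symmetric])
  ultimately show ?thesis by (rule Lim_transform_eventually)
qed

lemma z_eq:
  assumes "m \<ge> 1" shows "z m x = real (x choose s m) * sqrt (r m)"
proof -
  have N: "real (m choose s m) powr (- 1 / 2) = 1 / sqrt (N m)"
    using N_pos[OF assms] powr_minus_divide[of "N m" "1 / 2"] powr_half_sqrt[of "N m"]
    unfolding N_def by simp
  show ?thesis unfolding Z_scaled_def N powr_half_sqrt[OF of_nat_0_le_iff] r_def real_sqrt_divide by simp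
qed

lemma z_nonneg: "0 \<le> z m x"
  unfolding Z_scaled_def by (intro mult_nonneg_nonneg of_nat_0_le_iff powr_ge_zero)

lemma r_bounds: obtains R where "R > 0" "eventually (\<lambda>m. sqrt (r m) \<le> R) sequentially"
proof (rule that[of "1 / sqrt \<beta> + 1"])
  show "1 / sqrt \<beta> + 1 > 0" using beta_pos by (simp add: add_pos_pos)
  have "eventually (\<lambda>m. sqrt (r m) < 1 / sqrt \<beta> + 1) sequentially"
    by (rule order_tendstoD(2)[OF sqrt_r_lim]) simp
  then show "eventually (\<lambda>m. sqrt (r m) \<le> 1 / sqrt \<beta> + 1) sequentially"
    by eventually_elim simp
qed

text \<open>The factor \<open>2 ^ x\<close> bounds \<open>x choose s\<close> for every
  \<open>s\<close>, so the bound survives a varying \<open>s\<close>.\<close>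

lemma z_bounded: obtains B where "B > 0" "eventually (\<lambda>m. z m x \<le> B) sequentially"
proof -
  obtain R where R: "R > 0" "eventually (\<lambda>m. sqrt (r m) \<le> R) sequentially" by (rule r_bounds)
  show ?thesis
  proof (rule that[of "2 ^ x * R"])
    show "eventually (\<lambda>m. z m x \<le> 2 ^ x * R) sequentially"
      using R(2) ev_ge_1
    proof eventually_elim
      case (elim m)
      show ?case
        unfolding z_eq[OF elim(2)]
        by (rule mult_mono[OF real_choose_le_pow2 elim(1)]) (simp_all add: r_nonneg)
    qed
  qed (use R in simp)
qed

section \<open>Consequences of weak convergence for the first two moments\<close>

lemma weak_tendsto:
  fixes f :: "real \<Rightarrow> real"
  assumes "\<And>t. isCont f t" "\<And>t. \<bar>f t\<bar> \<le> B"
  shows "(\<lambda>m. E m (\<lambda>x. f (z m x))) \<longlonglongrightarrow> (\<integral>\<omega>. f (Z \<omega>) \<partial>M)"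
proof -
  have [measurable]: "f \<in> borel_measurable borel"
    using assms(1) by (intro borel_measurable_continuous_onI continuous_at_imp_continuous_on) auto
  have "(\<lambda>m. integral\<^sup>L (distr (measure_pmf (P m)) borel (z m)) f) \<longlonglongrightarrow> integral\<^sup>L (distr M borel Z) f"
  proof (rule weak_conv_imp_integral_bdd_continuous_conv[OF _ _ weak])
    show "real_distribution (distr (measure_pmf (P m)) borel (z m))" for m
      using measure_pmf.prob_space_distr[of "z m" "P m" borel]
        by (intro real_distribution.intro real_distribution_axioms.intro) simp_all
    show "real_distribution (distr M borel Z)"
      by (intro real_distribution.intro real_distribution_axioms.intro M.prob_space_distr Z_meas) simp
  qed (use assms in auto)
  then show ?thesis by (simp add: integral_distr)
qed

text \<open>\<open>Z\<close> is given only as a weak limit, so its sign has to be recovered: the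
  bounded continuous test function vanishes at every value of \<open>z m\<close> and is positive
  exactly on the negative half-line.\<close>

lemma Z_nonneg: "AE \<omega> in M. 0 \<le> Z \<omega>"
proof -
  let ?f = "\<lambda>t::real. min 1 (max 0 (- t))"
  have "(\<lambda>m. E m (\<lambda>x. ?f (z m x))) \<longlonglongrightarrow> (\<integral>\<omega>. ?f (Z \<omega>) \<partial>M)"
    by (rule weak_tendsto[of _ 1]) (auto intro!: continuous_intros)
  moreover have "?f (z m x) = 0" for m x using z_nonneg[of m x] by simp
  ultimately have "(\<integral>\<omega>. ?f (Z \<omega>) \<partial>M) = 0"
    by (simp add: LIMSEQ_const_iff)
  moreover have "integrable M (\<lambda>\<omega>. ?f (Z \<omega>))"
    by (rule M.integrable_const_bound[of _ 1]) auto
  ultimately have "AE \<omega> in M. ?f (Z \<omega>) = 0"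
    by (subst (asm) integral_nonneg_eq_0_iff_AE) auto
  then show ?thesis by eventually_elim (auto simp: min_def max_def split: if_splits)
qed

lemma Z_int: "integrable M Z"
  by (rule M.square_integrable_imp_integrable[OF Z_meas Z2_int])

lemma mean_nonneg: "0 \<le> mean m"
  unfolding mean_def by (intro Bochner_Integration.integral_nonneg z_nonneg)

lemma second_moment_bounded: "eventually (\<lambda>m. E m (\<lambda>x. (z m x)\<^sup>2) \<le> (\<integral>\<omega>. (Z \<omega>)\<^sup>2 \<partial>M) + 1) sequentially"
proof -
  have "eventually (\<lambda>m. E m (\<lambda>x. (z m x)\<^sup>2) < (\<integral>\<omega>. (Z \<omega>)\<^sup>2 \<partial>M) + 1) sequentially"
    by (rule order_tendstoD(2)[OF Z2_lim]) simp
  then show ?thesis by eventually_elim simp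
qed

lemma le_one_plus_square: "(t::real) \<le> 1 + t\<^sup>2"
proof -
  have "0 \<le> (t - 1/2)\<^sup>2" by simp
  then show ?thesis by (simp add: power2_eq_square algebra_simps)
qed

lemma diff_min_le:
  assumes "0 \<le> (t::real)" "0 < L" shows "0 \<le> t - min \<bar>t\<bar> L" "t - min \<bar>t\<bar> L \<le> t\<^sup>2 / L"
proof -
  show "0 \<le> t - min \<bar>t\<bar> L" using assms by simp
  show "t - min \<bar>t\<bar> L \<le> t\<^sup>2 / L"
  proof (cases "t \<le> L")
    case False
    then have "t * L \<le> t * t" using assms by (intro mult_left_mono) auto
    then have "t \<le> t\<^sup>2 / L" using assms by (simp add: field_simps power2_eq_square)
    then show ?thesis using False assms by simp
  qed (use assms in simp)
qed

text \<open>Weak convergence covers only bounded functions, so the identity is truncated at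
  \<open>L\<close>; by \<open>diff_min_le\<close> the truncation costs at most the second moment
  divided by \<open>L\<close>, uniformly in large \<open>m\<close>. The modulus keeps the test
  function bounded below as well.\<close>

lemma mean_lim: "mean \<longlonglongrightarrow> \<mu>"
proof (rule LIMSEQ_I)
  fix e :: real assume e: "0 < e"
  define V where "V = (\<integral>\<omega>. (Z \<omega>)\<^sup>2 \<partial>M) + 1"
  have V: "V > 0" using Z2_pos by (simp add: V_def)
  \<comment> \<open>Chosen so that \<open>V / L = e / 3\<close>. The \<open>+ 1\<close> in
    \<open>V\<close> lets the same constant bound the second moment of \<open>Z\<close> and,
    eventually, those of \<open>z m\<close>.\<close>
  define L where "L = 3 * V / e"
  have L: "L > 0" using V e by (simp add: L_def)
  have VL: "V / L = e / 3" using V e by (simp add: L_def)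
  let ?f = "\<lambda>t::real. min \<bar>t\<bar> L"
  have lim: "(\<lambda>m. E m (\<lambda>x. ?f (z m x))) \<longlonglongrightarrow> (\<integral>\<omega>. ?f (Z \<omega>) \<partial>M)"
    using L by (intro weak_tendsto[of _ L]) (auto intro!: continuous_intros)
  have intf: "integrable M (\<lambda>\<omega>. ?f (Z \<omega>))"
    using L by (intro M.integrable_const_bound[of _ L]) auto
  have a: "\<bar>\<mu> - (\<integral>\<omega>. ?f (Z \<omega>) \<partial>M)\<bar> \<le> e / 3"
  proof -
    have eq: "\<mu> - (\<integral>\<omega>. ?f (Z \<omega>) \<partial>M) = (\<integral>\<omega>. Z \<omega> - ?f (Z \<omega>) \<partial>M)"
      unfolding \<mu>_def by (rule Bochner_Integration.integral_diff[symmetric, OF Z_int intf])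
    have "0 \<le> (\<integral>\<omega>. Z \<omega> - ?f (Z \<omega>) \<partial>M)"
      by (rule integral_nonneg_AE) (use Z_nonneg in \<open>eventually_elim, use diff_min_le[OF _ L] in simp\<close>)
    moreover have "(\<integral>\<omega>. Z \<omega> - ?f (Z \<omega>) \<partial>M) \<le> (\<integral>\<omega>. (Z \<omega>)\<^sup>2 / L \<partial>M)"
    proof (rule integral_mono_AE)
      show "AE \<omega> in M. Z \<omega> - ?f (Z \<omega>) \<le> (Z \<omega>)\<^sup>2 / L"
        using Z_nonneg by eventually_elim (rule diff_min_le[OF _ L])
    qed (use Z_int intf Z2_int in auto)
    moreover have "(\<integral>\<omega>. (Z \<omega>)\<^sup>2 / L \<partial>M) \<le> V / L"
      using L by (simp add: V_def divide_right_mono)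
    ultimately show ?thesis unfolding eq VL[symmetric] abs_le_iff by linarith
  qed
  have "eventually (\<lambda>m. \<bar>E m (\<lambda>x. ?f (z m x)) - (\<integral>\<omega>. ?f (Z \<omega>) \<partial>M)\<bar> < e / 3) sequentially"
    using tendstoD[OF lim, of "e/3"] e by (simp add: dist_real_def)
  then have "eventually (\<lambda>m. norm (mean m - \<mu>) < e) sequentially"
    using second_moment_bounded ev_ge_1
  proof eventually_elim
    case (elim m)
    have eq: "mean m - E m (\<lambda>x. ?f (z m x)) = E m (\<lambda>x. z m x - ?f (z m x))"
      unfolding mean_def using elim by (intro Bochner_Integration.integral_diff[symmetric]) auto
    have "0 \<le> E m (\<lambda>x. z m x - ?f (z m x))"
      by (intro Bochner_Integration.integral_nonneg diff_min_le z_nonneg L)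
    moreover have "E m (\<lambda>x. z m x - ?f (z m x)) \<le> E m (\<lambda>x. (z m x)\<^sup>2 / L)"
      using elim by (intro expectation_P_mono diff_min_le z_nonneg L)
    moreover have "E m (\<lambda>x. (z m x)\<^sup>2 / L) \<le> V / L"
      using L elim(2) by (simp add: V_def divide_right_mono)
    ultimately have "\<bar>mean m - E m (\<lambda>x. ?f (z m x))\<bar> \<le> e / 3"
      unfolding eq VL[symmetric] abs_le_iff by linarith
    with a elim(1) show ?case
      unfolding real_norm_def abs_le_iff abs_less_iff by linarith
  qed
  then show "\<exists>no. \<forall>m\<ge>no. norm (mean m - \<mu>) < e"
    by (simp add: eventually_sequentially)
qed

lemma mean_bounded: obtains B where "B > 0" "eventually (\<lambda>m. mean m \<le> B) sequentially"
proof (rule that[of "\<bar>\<mu>\<bar> + 1"])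
  have "eventually (\<lambda>m. mean m < \<bar>\<mu>\<bar> + 1) sequentially"
    by (rule order_tendstoD(2)[OF mean_lim]) simp
  then show "eventually (\<lambda>m. mean m \<le> \<bar>\<mu>\<bar> + 1) sequentially"
    by eventually_elim simp
qed simp

lemma \<mu>_pos: "\<mu> > 0"
proof -
  have "0 \<le> \<mu>" unfolding \<mu>_def by (rule integral_nonneg_AE[OF Z_nonneg])
  moreover have "\<mu> \<noteq> 0"
  proof
    assume "\<mu> = 0"
    then have "AE \<omega> in M. Z \<omega> = 0"
      unfolding \<mu>_def using Z_nonneg by (subst (asm) integral_nonneg_eq_0_iff_AE[OF Z_int]) auto
    then have "(\<integral>\<omega>. (Z \<omega>)\<^sup>2 \<partial>M) = (\<integral>\<omega>. 0 \<partial>M)"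
      by (intro integral_cong_AE) auto
    with Z2_pos show False by simp
  qed
  ultimately show ?thesis by simp
qed

lemma truncated_second_moment_lim:
  "(\<lambda>L::nat. \<integral>\<omega>. min ((Z \<omega>)\<^sup>2) (real L) \<partial>M) \<longlonglongrightarrow> (\<integral>\<omega>. (Z \<omega>)\<^sup>2 \<partial>M)"
proof (rule integral_dominated_convergence[where w = "\<lambda>\<omega>. (Z \<omega>)\<^sup>2"])
  show "AE \<omega> in M. (\<lambda>L. min ((Z \<omega>)\<^sup>2) (real L)) \<longlonglongrightarrow> (Z \<omega>)\<^sup>2"
  proof (rule AE_I2)
    fix \<omega>
    have "eventually (\<lambda>L::nat. (Z \<omega>)\<^sup>2 \<le> real L) sequentially"
      by (rule eventually_sequentiallyI[of "nat \<lceil>(Z \<omega>)\<^sup>2\<rceil>"]) linarith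
    then have "eventually (\<lambda>L::nat. min ((Z \<omega>)\<^sup>2) (real L) = (Z \<omega>)\<^sup>2) sequentially"
      by eventually_elim simp
    then show "(\<lambda>L. min ((Z \<omega>)\<^sup>2) (real L)) \<longlonglongrightarrow> (Z \<omega>)\<^sup>2"
      by (rule tendsto_eventually)
  qed
qed (use Z2_int in auto)

text \<open>
  A large size \<open>x\<close> forces a large value of \<open>z m x\<close>, uniformly in \<open>m\<close>, because \<open>s\<close> is bounded.
\<close>

lemma tail_bound:
  assumes e: "e > 0"
  obtains K where "eventually (\<lambda>m. E m (\<lambda>x. of_bool (x > K) * (1 + (z m x)\<^sup>2)) \<le> e) sequentially"
proof -
  let ?V = "\<integral>\<omega>. (Z \<omega>)\<^sup>2 \<partial>M"
  obtain S where S: "S \<ge> 1" "eventually (\<lambda>m. s m \<le> S) sequentially" by (rule s_bounded)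
  have "eventually (\<lambda>L. ?V - e / 8 < (\<integral>\<omega>. min ((Z \<omega>)\<^sup>2) (real L) \<partial>M)) sequentially"
    using e by (intro order_tendstoD(1)[OF truncated_second_moment_lim]) simp
  then have "eventually (\<lambda>L. L \<ge> 1 \<and> ?V - e / 8 < (\<integral>\<omega>. min ((Z \<omega>)\<^sup>2) (real L) \<partial>M)) sequentially"
    using ev_ge_1 by eventually_elim simp
  then obtain L :: nat where L: "L \<ge> 1" "?V - e / 8 < (\<integral>\<omega>. min ((Z \<omega>)\<^sup>2) (real L) \<partial>M)"
    by (auto dest: eventually_happens)
  have lim: "(\<lambda>m. E m (\<lambda>x. min ((z m x)\<^sup>2) (real L))) \<longlonglongrightarrow> (\<integral>\<omega>. min ((Z \<omega>)\<^sup>2) (real L) \<partial>M)"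
    by (rule weak_tendsto[of _ "real L"]) (auto intro!: continuous_intros)
  have "(\<lambda>m. E m (\<lambda>x. (z m x)\<^sup>2) - E m (\<lambda>x. min ((z m x)\<^sup>2) (real L))) \<longlonglongrightarrow> ?V - (\<integral>\<omega>. min ((Z \<omega>)\<^sup>2) (real L) \<partial>M)"
    by (intro tendsto_diff Z2_lim lim)
  then have ev: "eventually (\<lambda>m. E m (\<lambda>x. (z m x)\<^sup>2) - E m (\<lambda>x. min ((z m x)\<^sup>2) (real L)) < e / 4) sequentially"
    by (rule order_tendstoD(2)) (use L e in simp)
  have evr: "eventually (\<lambda>m. 1 / (2 * \<beta>) < r m) sequentially"
    using beta_pos by (intro order_tendstoD(1)[OF r_lim]) (simp add: field_simps)
  \<comment> \<open>The summand \<open>S\<close> ensures \<open>x \<ge> s\<close> and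
    \<open>x / S \<ge> 1\<close>, so that squaring does not decrease. The other one gives
    \<open>x / S \<ge> 4 * L * \<beta>\<close>, which together with
    \<open>r > 1 / (2 * \<beta>)\<close> yields \<open>z^2 \<ge> 2 * L\<close>.\<close>
  define K where "K = S + nat \<lceil>4 * real L * \<beta> * real S\<rceil>"
  have K: "2 * real L \<le> (z m x)\<^sup>2" if "x > K" "s m \<le> S" "1 / (2 * \<beta>) < r m" "m \<ge> 1" for m x
  proof -
    let ?t = "real x / real S"
    have x: "real x \<ge> real S" "real x \<ge> 4 * real L * \<beta> * real S"
      using that(1) unfolding K_def by linarith+
    then have t: "?t \<ge> 1" "?t \<ge> 4 * real L * \<beta>" using S(1) by (simp_all add: field_simps)
    have c: "?t \<le> real (x choose s m)"
      using that x s_range[of m] by (intro choose_ge_over) auto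
    have "2 * real L = 4 * real L * \<beta> * (1 / (2 * \<beta>))" using beta_pos by simp
    also have "\<dots> \<le> (real (x choose s m))\<^sup>2 * r m"
    proof (intro mult_mono)
      have "4 * real L * \<beta> \<le> ?t" by (rule t)
      also have "?t \<le> real (x choose s m) * 1" using c by simp
      also have "\<dots> \<le> real (x choose s m) * real (x choose s m)" using c t by (intro mult_left_mono) auto
      finally show "4 * real L * \<beta> \<le> (real (x choose s m))\<^sup>2" by (simp add: power2_eq_square)
    qed (use that beta_pos in auto)
    also have "\<dots> = (z m x)\<^sup>2" using that by (simp add: z_eq power_mult_distrib r_nonneg)
    finally show ?thesis .
  qed
  have "eventually (\<lambda>m. E m (\<lambda>x. of_bool (x > K) * (1 + (z m x)\<^sup>2)) \<le> e) sequentially"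
    using ev evr S(2) ev_ge_1
  proof eventually_elim
    case (elim m)
    \<comment> \<open>Beyond size \<open>K\<close> the excess of \<open>z^2\<close> over
      \<open>L\<close> is at least \<open>z^2 / 2\<close>, while
      \<open>1 + z^2 \<le> 2 * z^2\<close> because \<open>L \<ge> 1\<close>. This gives the factor
      4, matched by the margin \<open>e / 4\<close> above.\<close>
    have "E m (\<lambda>x. of_bool (x > K) * (1 + (z m x)\<^sup>2)) \<le> E m (\<lambda>x. 4 * ((z m x)\<^sup>2 - min ((z m x)\<^sup>2) (real L)))"
    proof (rule expectation_P_mono[OF elim(4)])
      fix x
      show "of_bool (x > K) * (1 + (z m x)\<^sup>2) \<le> 4 * ((z m x)\<^sup>2 - min ((z m x)\<^sup>2) (real L))"
      proof (cases "x > K")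
        case True
        from K[OF this elim(3,2,4)] L(1) show ?thesis using True by (simp add: min_def)
      qed simp
    qed
    also have "\<dots> = 4 * (E m (\<lambda>x. (z m x)\<^sup>2) - E m (\<lambda>x. min ((z m x)\<^sup>2) (real L)))"
      using elim(4) by (subst Bochner_Integration.integral_diff[symmetric]) auto
    also have "\<dots> \<le> e" using elim(1) by simp
    finally show ?case .
  qed
  then show ?thesis by (rule that)
qed

text \<open>Dominated convergence along a changing sequence of distributions. Sizes up to
  \<open>K\<close> are finitely many, so pointwise limits suffice there; the larger ones are handled
  by \<open>tail_bound\<close>.\<close>

lemma expectation_P_tendsto_0:
  fixes H :: "nat \<Rightarrow> nat \<Rightarrow> real"
  assumes lim: "\<And>x. (\<lambda>m. H m x) \<longlonglongrightarrow> 0"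
    and bound: "eventually (\<lambda>m. \<forall>x\<le>m. \<bar>H m x\<bar> \<le> C * (1 + (z m x)\<^sup>2)) sequentially"
  shows "(\<lambda>m. E m (H m)) \<longlonglongrightarrow> 0"
proof (rule LIMSEQ_I)
  fix e :: real assume e: "0 < e"
  \<comment> \<open>The sign of \<open>C\<close> is unknown; \<open>C'\<close> is positive, so
    \<open>e / (2 * C')\<close> is a legitimate tolerance.\<close>
  define C' where "C' = max C 1"
  have C': "C \<le> C'" "C' > 0" by (auto simp: C'_def)
  obtain K where K: "eventually (\<lambda>m. E m (\<lambda>x. of_bool (x > K) * (1 + (z m x)\<^sup>2)) \<le> e / (2 * C')) sequentially"
    using e C' by (elim tail_bound[of "e / (2 * C')", rotated]) simp
  have "(\<lambda>m. \<Sum>i\<le>K. \<bar>H m i\<bar>) \<longlonglongrightarrow> (\<Sum>i\<le>K. \<bar>0\<bar>)"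
    by (intro tendsto_sum tendsto_rabs lim)
  then have "(\<lambda>m. \<Sum>i\<le>K. \<bar>H m i\<bar>) \<longlonglongrightarrow> 0" by simp
  then have "eventually (\<lambda>m. (\<Sum>i\<le>K. \<bar>H m i\<bar>) < e / 2) sequentially"
    by (rule order_tendstoD(2)) (use e in simp)
  then have "eventually (\<lambda>m. norm (E m (H m) - 0) < e) sequentially"
    using K bound ev_ge_1
  proof eventually_elim
    case (elim m)
    have "\<bar>E m (H m)\<bar> \<le> E m (\<lambda>x. \<bar>H m x\<bar>)" by (rule integral_abs_bound)
    also have "\<dots> \<le> E m (\<lambda>x. (\<Sum>i\<le>K. \<bar>H m i\<bar>) + C' * (of_bool (x > K) * (1 + (z m x)\<^sup>2)))"
    proof (rule expectation_P_mono[OF elim(4)])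
      fix x assume x: "x \<le> m"
      show "\<bar>H m x\<bar> \<le> (\<Sum>i\<le>K. \<bar>H m i\<bar>) + C' * (of_bool (x > K) * (1 + (z m x)\<^sup>2))"
      proof (cases "x \<le> K")
        case True
        then have "\<bar>H m x\<bar> \<le> (\<Sum>i\<le>K. \<bar>H m i\<bar>)" by (intro member_le_sum) auto
        then show ?thesis using True by simp
      next
        case False
        have "\<bar>H m x\<bar> \<le> C * (1 + (z m x)\<^sup>2)" using elim x by blast
        also have "\<dots> \<le> C' * (1 + (z m x)\<^sup>2)" using C' by (intro mult_right_mono) auto
        finally show ?thesis using False by (simp add: sum_nonneg add_increasing)
      qed
    qed
    also have "\<dots> = (\<Sum>i\<le>K. \<bar>H m i\<bar>) + C' * E m (\<lambda>x. of_bool (x > K) * (1 + (z m x)\<^sup>2))"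
      using elim(4) by (subst Bochner_Integration.integral_add) simp_all
    also have "\<dots> < e / 2 + C' * (e / (2 * C'))"
      using elim(1,2) C' by (intro add_less_le_mono mult_left_mono) auto
    also have "\<dots> = e" using C' by simp
    finally show ?case by simp
  qed
  then show "\<exists>no. \<forall>m\<ge>no. norm (E m (H m) - 0) < e"
    by (simp add: eventually_sequentially)
qed

text \<open>A choice of one set of size \<open>x\<close> for every \<open>m\<close> large enough to
  admit one. A limit along all such sequences expresses uniformity over the sets of that
  size.\<close>

definition set_seq :: "nat \<Rightarrow> (nat \<Rightarrow> nat set) \<Rightarrow> bool" where
  "set_seq x A \<longleftrightarrow> (\<forall>m\<ge>x. A m \<subseteq> {1..m} \<and> card (A m) = x)"

abbreviation R where "R m \<equiv> random_subset m (P m)"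

text \<open>Carries \<open>expectation_P_tendsto_0\<close> from sizes to sets. Limits are required
  along single sequences only, so the later limit lemmas can treat one set per
  \<open>m\<close>.\<close>

lemma expectation_random_subset_tendsto_0:
  fixes H :: "nat \<Rightarrow> nat set \<Rightarrow> real"
  assumes lim: "\<And>x A. set_seq x A \<Longrightarrow> (\<lambda>m. H m (A m)) \<longlonglongrightarrow> 0"
    and bound: "eventually (\<lambda>m. \<forall>A\<subseteq>{1..m}. \<bar>H m A\<bar> \<le> C * (1 + (z m (card A))\<^sup>2)) sequentially"
  shows "(\<lambda>m. measure_pmf.expectation (R m) (H m)) \<longlonglongrightarrow> 0"
proof -
  \<comment> \<open>a worst set of each size turns the hypothesis on sequences into uniformity over sets\<close>
  define worst where "worst m x A \<longleftrightarrow> (x \<le> m \<longrightarrow> A \<subseteq> {1..m} \<and> card A = x \<and>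
      (\<forall>B. B \<subseteq> {1..m} \<and> card B = x \<longrightarrow> \<bar>H m B\<bar> \<le> \<bar>H m A\<bar>))" for m x A
  have ex: "\<exists>A. worst m x A" for m x
  proof (cases "x \<le> m")
    case True
    let ?S = "{A. A \<subseteq> {1..m} \<and> card A = x}"
    have "Max ((\<lambda>A. \<bar>H m A\<bar>) ` ?S) \<in> (\<lambda>A. \<bar>H m A\<bar>) ` ?S"
      using finite_subsets_card[of m x] subsets_card_nonempty[OF True] by (intro Max_in) auto
    then obtain A where A: "A \<in> ?S" "Max ((\<lambda>A. \<bar>H m A\<bar>) ` ?S) = \<bar>H m A\<bar>" by auto
    have "\<bar>H m B\<bar> \<le> \<bar>H m A\<bar>" if "B \<in> ?S" for B
      unfolding A(2)[symmetric] using finite_subsets_card[of m x] that by (intro Max_ge) auto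
    with A(1) show ?thesis unfolding worst_def by blast
  qed (simp add: worst_def)
  define A where "A m x = (SOME A. worst m x A)" for m x
  have "worst m x (A m x)" for m x
    unfolding A_def by (rule someI_ex[OF ex])
  then have A: "A m x \<subseteq> {1..m}" "card (A m x) = x"
    "\<And>B. B \<subseteq> {1..m} \<Longrightarrow> card B = x \<Longrightarrow> \<bar>H m B\<bar> \<le> \<bar>H m (A m x)\<bar>" if "x \<le> m" for m x
    using that unfolding worst_def by blast+
  define h where "h m x = \<bar>H m (A m x)\<bar>" for m x
  have "(\<lambda>m. E m (h m)) \<longlonglongrightarrow> 0"
  proof (rule expectation_P_tendsto_0)
    show "(\<lambda>m. h m x) \<longlonglongrightarrow> 0" for x
    proof -
      have "set_seq x (\<lambda>m. A m x)" unfolding set_seq_def using A(1,2) by blast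
      then show ?thesis unfolding h_def by (intro tendsto_rabs_zero lim)
    qed
    show "eventually (\<lambda>m. \<forall>x\<le>m. \<bar>h m x\<bar> \<le> C * (1 + (z m x)\<^sup>2)) sequentially"
      using bound
    proof eventually_elim
      case (elim m)
      show ?case
      proof (intro allI impI)
        fix x assume "x \<le> m"
        with elim A(1,2)[OF this] show "\<bar>h m x\<bar> \<le> C * (1 + (z m x)\<^sup>2)" unfolding h_def by (metis abs_abs)
      qed
    qed
  qed
  moreover have "eventually (\<lambda>m. norm (measure_pmf.expectation (R m) (H m)) \<le> E m (h m)) sequentially"
    using ev_ge_1
  proof eventually_elim
    case (elim m)
    note fin = finite_set_random_subset[OF P_range[OF elim]]
    have "\<bar>measure_pmf.expectation (R m) (H m)\<bar> \<le> measure_pmf.expectation (R m) (\<lambda>B. \<bar>H m B\<bar>)"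
      by (rule integral_abs_bound)
    also have "\<dots> \<le> measure_pmf.expectation (R m) (\<lambda>B. h m (card B))"
    proof (intro integral_mono_AE AE_pmfI integrable_measure_pmf_finite fin)
      fix B assume "B \<in> set_pmf (R m)"
      then have B: "B \<subseteq> {1..m}" using set_random_subset[OF P_range[OF elim]] by auto
      then have "card B \<le> m" using card_mono[of "{1..m}" B] by simp
      from A(3)[OF this B refl] show "\<bar>H m B\<bar> \<le> h m (card B)" by (simp add: h_def)
    qed
    also have "\<dots> = E m (h m)" by (rule expectation_random_subset_card[OF P_range[OF elim]])
    finally show ?case by simp
  qed
  ultimately show ?thesis by (rule Lim_null_comparison[rotated])
qed

end

section \<open>Asymptotics\<close>

text \<open>The usual product rule for limits does not apply, since the factors may oscillate;
  boundedness of one factor on each side suffices after telescoping the difference.\<close>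

lemma tendsto_mult_diff_0:
  fixes a a' b b' :: "nat \<Rightarrow> real"
  assumes a: "(\<lambda>m. a m - a' m) \<longlonglongrightarrow> 0" and b: "(\<lambda>m. b m - b' m) \<longlonglongrightarrow> 0"
    and Kb: "eventually (\<lambda>m. \<bar>b m\<bar> \<le> Kb) sequentially" and Ka: "eventually (\<lambda>m. \<bar>a' m\<bar> \<le> Ka) sequentially"
  shows "(\<lambda>m. a m * b m - a' m * b' m) \<longlonglongrightarrow> 0"
proof (rule Lim_null_comparison)
  show "eventually (\<lambda>m. norm (a m * b m - a' m * b' m) \<le> \<bar>a m - a' m\<bar> * Kb + Ka * \<bar>b m - b' m\<bar>) sequentially"
    using Kb Ka
  proof eventually_elim
    case (elim m)
    have "a m * b m - a' m * b' m = (a m - a' m) * b m + a' m * (b m - b' m)"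
      by (simp add: algebra_simps)
    also have "\<bar>\<dots>\<bar> \<le> \<bar>a m - a' m\<bar> * \<bar>b m\<bar> + \<bar>a' m\<bar> * \<bar>b m - b' m\<bar>"
      unfolding abs_mult[symmetric] by (rule abs_triangle_ineq)
    also have "\<dots> \<le> \<bar>a m - a' m\<bar> * Kb + Ka * \<bar>b m - b' m\<bar>"
      by (intro add_mono mult_left_mono mult_right_mono elim) auto
    finally show ?case by simp
  qed
  show "(\<lambda>m. \<bar>a m - a' m\<bar> * Kb + Ka * \<bar>b m - b' m\<bar>) \<longlonglongrightarrow> 0"
    using tendsto_add[OF tendsto_mult[OF tendsto_rabs[OF a] tendsto_const[of Kb]]
        tendsto_mult[OF tendsto_const[of Ka] tendsto_rabs[OF b]]] by simp
qed

context intersection_graph_seq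
begin

abbreviation link where "link m \<equiv> link_prob (s m) m (P m)"
abbreviation tri where "tri m \<equiv> triangle_prob m (s m)"
definition tau where "tau m A = E m (\<lambda>y. E m (\<lambda>w. tri m A y w))"
abbreviation ch where "ch m x \<equiv> real (x choose s m)"

lemma z_mult: "m \<ge> 1 \<Longrightarrow> z m x * z m y = ch m x * ch m y * r m"
  using r_nonneg[of m] by (simp add: z_eq)

lemma n_pair_eq: "m \<ge> 1 \<Longrightarrow> real (n m) * (ch m x * ch m y / real (m choose s m)) = z m x * z m y"
  by (simp add: z_mult r_def N_def)

text \<open>The origin of \<open>1 / sqrt \<beta>\<close>: the left side carries \<open>r^2\<close>,
  three values of \<open>z\<close> absorb \<open>r\<close> to the power 3/2, and one factor
  \<open>sqrt r\<close> is left over.\<close>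

lemma n_triple_eq:
  assumes "m \<ge> 1"
  shows "(real (n m))\<^sup>2 * (ch m x * ch m y * ch m w / (real (m choose s m))\<^sup>2) = sqrt (r m) * z m x * z m y * z m w"
proof -
  have "sqrt (r m) * z m x * z m y * z m w = (sqrt (r m) * sqrt (r m)) * (ch m w * ch m x * ch m y * r m)"
    unfolding z_eq[OF assms, of w] using z_mult[OF assms, of x y] by (simp add: algebra_simps)
  also have "sqrt (r m) * sqrt (r m) = r m" using r_nonneg by simp
  finally show ?thesis by (simp add: r_def N_def power2_eq_square)
qed

lemma z_le_square: "z m x \<le> 1 + (z m x)\<^sup>2"
  by (rule le_one_plus_square)

lemma link_eq:
  assumes "m \<ge> 1"
  shows "link m A = E m (\<lambda>y. measure_pmf.expectation (uniform_subset m y) (meets (s m) A))"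
  unfolding link_prob_def by (rule expectation_random_subset[OF P_range[OF assms]])

lemma set_seqD:
  assumes "set_seq x A" "x \<le> m" shows "A m \<subseteq> {1..m}" "card (A m) = x"
  using assms unfolding set_seq_def by blast+

text \<open>At a fixed \<open>y\<close> the error is of order \<open>n / N'\<close>. For arbitrary
  \<open>y\<close> the scaled probability and its target both lie between 0 and
  \<open>z m x * z m y\<close>, where \<open>z m x\<close> is bounded because \<open>x\<close> is
  fixed.\<close>

lemma link_lim:
  assumes A: "set_seq x A"
  shows "(\<lambda>m. real (n m) * link m (A m) - z m x * mean m) \<longlonglongrightarrow> 0"
proof -
  define f where "f m y = measure_pmf.expectation (uniform_subset m y) (meets (s m) (A m))" for m y
  define H where "H m y = real (n m) * f m y - z m x * z m y" for m y
  obtain B where B: "B > 0" "eventually (\<lambda>m. z m x \<le> B) sequentially" by (rule z_bounded)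
  have "(\<lambda>m. E m (H m)) \<longlonglongrightarrow> 0"
  proof (rule expectation_P_tendsto_0)
    fix y
    have lim: "(\<lambda>m. (2 ^ (x + y))\<^sup>2 * (real (n m) / N' m)) \<longlonglongrightarrow> 0"
      using tendsto_mult[OF tendsto_const n_over_N'_lim] by simp
    show "(\<lambda>m. H m y) \<longlonglongrightarrow> 0"
    proof (rule Lim_null_comparison[OF _ lim])
      show "eventually (\<lambda>m. norm (H m y) \<le> (2 ^ (x + y))\<^sup>2 * (real (n m) / N' m)) sequentially"
        using ev_ge_1 eventually_ge_at_top[of x] eventually_ge_at_top[of y]
      proof eventually_elim
        case (elim m)
        have "H m y = real (n m) * (f m y - ch m x * ch m y / real (m choose s m))"
          unfolding H_def n_pair_eq[OF elim(1), symmetric] by (simp only: right_diff_distrib)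
        then have "\<bar>H m y\<bar> = real (n m) * \<bar>f m y - ch m x * ch m y / real (m choose s m)\<bar>"
          by (simp add: abs_mult)
        also have "\<dots> \<le> real (n m) * ((2 ^ (x + y))\<^sup>2 / real (m choose Suc (s m)))"
          unfolding f_def
          by (intro mult_left_mono expectation_meets_approx[OF set_seqD[OF A elim(2)] elim(3)]) simp
        finally show ?case unfolding N'_def real_norm_def by (simp add: mult.commute)
      qed
    qed
  next
    show "eventually (\<lambda>m. \<forall>y\<le>m. \<bar>H m y\<bar> \<le> B * (1 + (z m y)\<^sup>2)) sequentially"
      using B(2) ev_ge_1 eventually_ge_at_top[of x]
    proof eventually_elim
      case (elim m)
      show ?case
      proof (intro allI impI)
        fix y assume y: "y \<le> m"
        have "f m y \<le> ch m x * ch m y / real (m choose s m)"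
          unfolding f_def by (rule expectation_meets_le[OF set_seqD[OF A elim(3)] y])
        then have "real (n m) * f m y \<le> z m x * z m y"
          unfolding n_pair_eq[OF elim(2), symmetric] by (intro mult_left_mono) auto
        moreover have "0 \<le> real (n m) * f m y"
          unfolding f_def by (intro mult_nonneg_nonneg Bochner_Integration.integral_nonneg meets_bounds) simp
        ultimately have "\<bar>H m y\<bar> \<le> z m x * z m y"
          unfolding H_def abs_le_iff by linarith
        also have "\<dots> \<le> B * (1 + (z m y)\<^sup>2)"
          using B(1) by (intro mult_mono elim z_le_square z_nonneg) simp
        finally show "\<bar>H m y\<bar> \<le> B * (1 + (z m y)\<^sup>2)" .
      qed
    qed
  qed
  moreover have "eventually (\<lambda>m. E m (H m) = real (n m) * link m (A m) - z m x * mean m) sequentially"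
    using ev_ge_1
  proof eventually_elim
    case (elim m)
    have "E m (H m) = E m (\<lambda>y. real (n m) * f m y) - E m (\<lambda>y. z m x * z m y)"
      unfolding H_def using elim by (intro Bochner_Integration.integral_diff) simp_all
    then show ?case unfolding link_eq[OF elim] mean_def f_def by simp
  qed
  ultimately show ?thesis by (rule Lim_transform_eventually)
qed

lemma tri_le:
  assumes "m \<ge> 1" "A \<subseteq> {1..m}" "card A = x" "y \<le> m" "w \<le> m"
  shows "(real (n m))\<^sup>2 * tri m A y w \<le> (z m x * z m y) * (z m x * z m w)"
proof -
  have "(real (n m))\<^sup>2 * tri m A y w \<le> (real (n m))\<^sup>2 *
     ((ch m x * ch m y / real (m choose s m)) * (ch m x * ch m w / real (m choose s m)))"
    by (intro mult_left_mono triangle_prob_le_prod[OF assms(2-5)]) simp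
  also have "\<dots> = (z m x * z m y) * (z m x * z m w)"
    unfolding n_pair_eq[OF assms(1), symmetric] by (simp only: power2_eq_square ac_simps)
  finally show ?thesis .
qed

text \<open>Two sizes are averaged, so dominated convergence is used twice, first in
  \<open>w\<close> with \<open>y\<close> fixed and then in \<open>y\<close>. The bound by a multiple
  of \<open>z m y * z m w\<close> serves both passes.\<close>

lemma tau_lim:
  assumes A: "set_seq x A"
  shows "(\<lambda>m. (real (n m))\<^sup>2 * tau m (A m) - sqrt (r m) * z m x * (mean m)\<^sup>2) \<longlonglongrightarrow> 0"
proof -
  define K where "K m y w = (real (n m))\<^sup>2 * tri m (A m) y w - sqrt (r m) * z m x * z m y * z m w" for m y w
  define H where "H m y = E m (K m y)" for m y
  obtain B where B: "B > 0" "eventually (\<lambda>m. z m x \<le> B) sequentially" by (rule z_bounded)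
  obtain Q where Q: "Q > 0" "eventually (\<lambda>m. sqrt (r m) \<le> Q) sequentially" by (rule r_bounds)
  obtain V where V: "V > 0" "eventually (\<lambda>m. mean m \<le> V) sequentially" by (rule mean_bounded)
  \<comment> \<open>\<open>B * B\<close> comes from \<open>tri_le\<close> and \<open>Q * B\<close>
    from the comparison term; both terms are nonnegative, so the sum dominates their
    difference.\<close>
  define C where "C = B * B + Q * B"
  have C: "C > 0" using B Q by (simp add: C_def add_pos_pos)
  have K_bound: "eventually (\<lambda>m. \<forall>y\<le>m. \<forall>w\<le>m. \<bar>K m y w\<bar> \<le> C * (z m y * z m w)) sequentially"
    using B(2) Q(2) ev_ge_1 eventually_ge_at_top[of x]
  proof eventually_elim
    case (elim m)
    show ?case
    proof (intro allI impI)
      fix y w assume yw: "y \<le> m" "w \<le> m"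
      note d = set_seqD[OF A elim(4)]
      have zz: "0 \<le> z m y * z m w" by (intro mult_nonneg_nonneg z_nonneg)
      have "(real (n m))\<^sup>2 * tri m (A m) y w \<le> (z m x * z m x) * (z m y * z m w)"
        using tri_le[OF elim(3) d yw] by (simp only: ac_simps)
      also have "\<dots> \<le> (B * B) * (z m y * z m w)"
        using elim(1) z_nonneg zz B(1) by (intro mult_right_mono mult_mono) auto
      finally have 1: "(real (n m))\<^sup>2 * tri m (A m) y w \<le> (B * B) * (z m y * z m w)" .
      have 2: "0 \<le> (real (n m))\<^sup>2 * tri m (A m) y w"
        by (intro mult_nonneg_nonneg triangle_prob_nonneg[OF d yw]) simp
      have "sqrt (r m) * z m x * z m y * z m w = (sqrt (r m) * z m x) * (z m y * z m w)"
        by (simp only: ac_simps)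
      also have "\<dots> \<le> (Q * B) * (z m y * z m w)"
        using elim(1,2) z_nonneg zz B(1) Q(1) by (intro mult_right_mono mult_mono) auto
      finally have 3: "sqrt (r m) * z m x * z m y * z m w \<le> (Q * B) * (z m y * z m w)" .
      have 4: "0 \<le> sqrt (r m) * z m x * z m y * z m w"
        by (intro mult_nonneg_nonneg z_nonneg) (simp add: r_nonneg)
      have "\<bar>K m y w\<bar> \<le> (B * B) * (z m y * z m w) + (Q * B) * (z m y * z m w)"
        unfolding K_def abs_le_iff using 1 2 3 4 by linarith
      then show "\<bar>K m y w\<bar> \<le> C * (z m y * z m w)" by (simp only: C_def distrib_right)
    qed
  qed
  have K_lim: "(\<lambda>m. K m y w) \<longlonglongrightarrow> 0" for y w
  proof (rule Lim_null_comparison)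
    \<comment> \<open>The size constant of \<open>triangle_prob_approx\<close>. Its two errors times
      \<open>n^2\<close> become \<open>W * (n / N')^2\<close> and
      \<open>W * r * (n / N')\<close>.\<close>
    define W where "W = (2 ^ (x + y + w) :: real)\<^sup>2"
    show "eventually (\<lambda>m. norm (K m y w) \<le> W * (real (n m) / N' m)\<^sup>2 + W * (r m * (real (n m) / N' m))) sequentially"
      using ev_ge_1 eventually_ge_at_top[of x] eventually_ge_at_top[of y] eventually_ge_at_top[of w]
    proof eventually_elim
      case (elim m)
      note d = set_seqD[OF A elim(2)]
      have "K m y w = (real (n m))\<^sup>2 * (tri m (A m) y w - ch m x * ch m y * ch m w / (real (m choose s m))\<^sup>2)"
        unfolding K_def n_triple_eq[OF elim(1), symmetric] by (simp only: right_diff_distrib)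
      then have "\<bar>K m y w\<bar> = (real (n m))\<^sup>2 * \<bar>tri m (A m) y w - ch m x * ch m y * ch m w / (real (m choose s m))\<^sup>2\<bar>"
        by (simp add: abs_mult)
      also have "\<dots> \<le> (real (n m))\<^sup>2 * (W / (real (m choose Suc (s m)))\<^sup>2
          + W / (real (m choose s m) * real (m choose Suc (s m))))"
        unfolding W_def by (intro mult_left_mono triangle_prob_approx[OF d elim(3,4)]) simp
      also have "\<dots> = W * (real (n m) / N' m)\<^sup>2 + W * (r m * (real (n m) / N' m))"
        unfolding r_def N_def N'_def distrib_left by (simp add: power2_eq_square ac_simps)
      finally show ?case by simp
    qed
    have "(\<lambda>m. W * (real (n m) / N' m)\<^sup>2 + W * (r m * (real (n m) / N' m))) \<longlonglongrightarrow> W * 0\<^sup>2 + W * (1 / \<beta> * 0)"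
      by (intro tendsto_add tendsto_mult tendsto_power tendsto_const n_over_N'_lim r_lim)
    then show "(\<lambda>m. W * (real (n m) / N' m)\<^sup>2 + W * (r m * (real (n m) / N' m))) \<longlonglongrightarrow> 0" by simp
  qed
  have H_lim: "(\<lambda>m. H m y) \<longlonglongrightarrow> 0" for y
  proof -
    obtain By where By: "By > 0" "eventually (\<lambda>m. z m y \<le> By) sequentially" by (rule z_bounded)
    have "eventually (\<lambda>m. \<forall>w\<le>m. \<bar>K m y w\<bar> \<le> (C * By) * (1 + (z m w)\<^sup>2)) sequentially"
      using K_bound By(2) eventually_ge_at_top[of y]
    proof eventually_elim
      case (elim m)
      show ?case
      proof (intro allI impI)
        fix w assume "w \<le> m"
        with elim have "\<bar>K m y w\<bar> \<le> C * (z m y * z m w)" by blast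
        also have "\<dots> \<le> C * (By * (1 + (z m w)\<^sup>2))"
          using C By(1) by (intro mult_left_mono mult_mono elim z_le_square z_nonneg) auto
        finally show "\<bar>K m y w\<bar> \<le> (C * By) * (1 + (z m w)\<^sup>2)" by (simp only: mult.assoc)
      qed
    qed
    then show ?thesis unfolding H_def by (rule expectation_P_tendsto_0[OF K_lim])
  qed
  have "(\<lambda>m. E m (H m)) \<longlonglongrightarrow> 0"
  proof (rule expectation_P_tendsto_0[OF H_lim])
    show "eventually (\<lambda>m. \<forall>y\<le>m. \<bar>H m y\<bar> \<le> (C * V) * (1 + (z m y)\<^sup>2)) sequentially"
      using K_bound V(2) ev_ge_1
    proof eventually_elim
      case (elim m)
      show ?case
      proof (intro allI impI)
        fix y assume y: "y \<le> m"
        have "\<bar>H m y\<bar> \<le> E m (\<lambda>w. \<bar>K m y w\<bar>)" unfolding H_def by (rule integral_abs_bound)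
        also have "\<dots> \<le> E m (\<lambda>w. C * (z m y * z m w))"
          using elim(1) y by (intro expectation_P_mono[OF elim(3)]) blast
        also have "\<dots> = C * (mean m * z m y)" unfolding mean_def by simp
        also have "\<dots> \<le> C * (V * (1 + (z m y)\<^sup>2))"
          using C V(1) by (intro mult_left_mono mult_mono elim z_le_square z_nonneg) auto
        finally show "\<bar>H m y\<bar> \<le> (C * V) * (1 + (z m y)\<^sup>2)" by (simp only: mult.assoc)
      qed
    qed
  qed
  moreover have "eventually (\<lambda>m. E m (H m) = (real (n m))\<^sup>2 * tau m (A m) - sqrt (r m) * z m x * (mean m)\<^sup>2) sequentially"
    using ev_ge_1
  proof eventually_elim
    case (elim m)
    have "H m = (\<lambda>y. (real (n m))\<^sup>2 * E m (tri m (A m) y) - sqrt (r m) * z m x * mean m * z m y)"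
    proof
      fix y
      have "H m y = E m (\<lambda>w. (real (n m))\<^sup>2 * tri m (A m) y w) - E m (\<lambda>w. sqrt (r m) * z m x * z m y * z m w)"
        unfolding H_def K_def using elim by (intro Bochner_Integration.integral_diff) simp_all
      then show "H m y = (real (n m))\<^sup>2 * E m (tri m (A m) y) - sqrt (r m) * z m x * mean m * z m y"
        unfolding mean_def by simp
    qed
    then have "E m (H m) = E m (\<lambda>y. (real (n m))\<^sup>2 * E m (tri m (A m) y)) - E m (\<lambda>y. sqrt (r m) * z m x * mean m * z m y)"
      by (simp only:) (intro Bochner_Integration.integral_diff integrable_P elim)
    also have "\<dots> = (real (n m))\<^sup>2 * tau m (A m) - sqrt (r m) * z m x * mean m * mean m"
      unfolding tau_def mean_def by simp
    finally show ?case by (simp add: power2_eq_square)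
  qed
  ultimately show ?thesis by (rule Lim_transform_eventually)
qed

text \<open>Quadratic in \<open>z\<close>, hence just within reach of domination by
  \<open>1 + z^2\<close>.\<close>

lemma tau_le:
  assumes m: "m \<ge> 1" and A: "A \<subseteq> {1..m}"
  shows "(real (n m))\<^sup>2 * tau m A \<le> (z m (card A) * mean m)\<^sup>2"
proof -
  have "(real (n m))\<^sup>2 * tau m A = E m (\<lambda>y. E m (\<lambda>w. (real (n m))\<^sup>2 * tri m A y w))"
    unfolding tau_def by simp
  also have "\<dots> \<le> E m (\<lambda>y. E m (\<lambda>w. (z m (card A) * z m y) * (z m (card A) * z m w)))"
    by (intro expectation_P_mono m tri_le[OF m A refl])
  also have "\<dots> = (z m (card A) * mean m)\<^sup>2"
    unfolding mean_def by (simp add: power2_eq_square)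
  finally show ?thesis .
qed

lemma tau_nonneg:
  assumes m: "m \<ge> 1" and A: "A \<subseteq> {1..m}"
  shows "0 \<le> tau m A"
proof -
  have "E m (\<lambda>y. E m (\<lambda>w. 0)) \<le> tau m A"
    unfolding tau_def by (intro expectation_P_mono m triangle_prob_nonneg[OF A refl])
  then show ?thesis by simp
qed

lemma link_le:
  assumes m: "m \<ge> 1" and A: "A \<subseteq> {1..m}"
  shows "real (n m) * link m A \<le> z m (card A) * mean m"
proof -
  have "real (n m) * link m A \<le> real (n m) * E m (\<lambda>y. ch m (card A) * ch m y / real (m choose s m))"
    unfolding link_eq[OF m]
    by (intro mult_left_mono expectation_P_mono m expectation_meets_le[OF A refl]) simp_all
  also have "\<dots> = E m (\<lambda>y. real (n m) * (ch m (card A) * ch m y / real (m choose s m)))"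
    by (rule Bochner_Integration.integral_mult_right_zero[symmetric])
  also have "\<dots> = z m (card A) * mean m"
    unfolding n_pair_eq[OF m] mean_def by simp
  finally show ?thesis .
qed

lemma z_mean_bounded: obtains B where "B > 0" "eventually (\<lambda>m. z m x * mean m \<le> B) sequentially"
proof -
  obtain B where B: "B > 0" "eventually (\<lambda>m. z m x \<le> B) sequentially" by (rule z_bounded)
  obtain V where V: "V > 0" "eventually (\<lambda>m. mean m \<le> V) sequentially" by (rule mean_bounded)
  have "eventually (\<lambda>m. z m x * mean m \<le> B * V) sequentially"
    using B(2) V(2) by eventually_elim (intro mult_mono mean_nonneg, use B in auto)
  with B V show ?thesis by (intro that[of "B * V"]) auto
qed

lemma binomial_lim:
  assumes A: "set_seq x A"
  shows "(\<lambda>m. binomial_weight (n m - 3) (link m (A m)) j - poisson_weight j (z m x * mean m)) \<longlonglongrightarrow> 0"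
proof -
  obtain B where B: "B > 0" "eventually (\<lambda>m. z m x * mean m \<le> B) sequentially" by (rule z_mean_bounded)
  show ?thesis
    by (rule tendsto_binomial_weight_poisson[OF link_prob_bounds _ B(2) n_at_top link_lim[OF A]])
       (intro mult_nonneg_nonneg z_nonneg mean_nonneg)
qed

lemma mean_square_bounded:
  obtains V where "V > 0" "eventually (\<lambda>m. (mean m)\<^sup>2 \<le> V) sequentially"
proof -
  obtain V where V: "V > 0" "eventually (\<lambda>m. mean m \<le> V) sequentially" by (rule mean_bounded)
  have "eventually (\<lambda>m. (mean m)\<^sup>2 \<le> V\<^sup>2) sequentially"
    using V(2) by eventually_elim (intro power_mono mean_nonneg)
  with V show ?thesis by (intro that[of "V\<^sup>2"]) auto
qed

text \<open>Here \<open>j\<close> is \<open>k - 2\<close>. Of the comparison term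
  \<open>sqrt r * z * mean^2\<close> one factor \<open>z * mean\<close> is absorbed by the Poisson
  weight, which leaves \<open>sqrt r * mean\<close> and the factor \<open>Suc j\<close>.\<close>

lemma numerator_lim:
  "(\<lambda>m. (real (n m))\<^sup>2 * measure_pmf.expectation (R m) (\<lambda>A. tau m A * binomial_weight (n m - 3) (link m A) j)
    - sqrt (r m) * mean m * real (Suc j) * E m (\<lambda>x. poisson_weight (Suc j) (z m x * mean m))) \<longlonglongrightarrow> 0"
proof -
  define G where "G m x = sqrt (r m) * z m x * (mean m)\<^sup>2 * poisson_weight j (z m x * mean m)" for m x
  define H where "H m A = (real (n m))\<^sup>2 * tau m A * binomial_weight (n m - 3) (link m A) j - G m (card A)" for m A
  obtain Q where Q: "Q > 0" "eventually (\<lambda>m. sqrt (r m) \<le> Q) sequentially" by (rule r_bounds)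
  obtain V where V: "V > 0" "eventually (\<lambda>m. (mean m)\<^sup>2 \<le> V) sequentially" by (rule mean_square_bounded)
  have G: "0 \<le> G m x" "G m x \<le> sqrt (r m) * z m x * (mean m)\<^sup>2" for m x
  proof -
    have *: "0 \<le> sqrt (r m) * z m x * (mean m)\<^sup>2"
      by (intro mult_nonneg_nonneg z_nonneg) (simp_all add: r_nonneg)
    have **: "0 \<le> z m x * mean m" by (intro mult_nonneg_nonneg z_nonneg mean_nonneg)
    show "0 \<le> G m x" unfolding G_def by (intro mult_nonneg_nonneg[OF *] poisson_weight_nonneg **)
    show "G m x \<le> sqrt (r m) * z m x * (mean m)\<^sup>2"
      unfolding G_def by (rule mult_left_le[OF poisson_weight_le_1[OF **] *])
  qed
  have "(\<lambda>m. measure_pmf.expectation (R m) (H m)) \<longlonglongrightarrow> 0"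
  proof (rule expectation_random_subset_tendsto_0)
    fix x A assume A: "set_seq x A"
    obtain B where B: "B > 0" "eventually (\<lambda>m. z m x \<le> B) sequentially" by (rule z_bounded)
    have "(\<lambda>m. (real (n m))\<^sup>2 * tau m (A m) * binomial_weight (n m - 3) (link m (A m)) j - G m x) \<longlonglongrightarrow> 0"
      unfolding G_def
    proof (rule tendsto_mult_diff_0[OF tau_lim[OF A] binomial_lim[OF A]])
      show "eventually (\<lambda>m. \<bar>binomial_weight (n m - 3) (link m (A m)) j\<bar> \<le> 1) sequentially"
        using binomial_weight_bounds[OF link_prob_bounds] by (intro always_eventually) simp
      show "eventually (\<lambda>m. \<bar>sqrt (r m) * z m x * (mean m)\<^sup>2\<bar> \<le> Q * B * V) sequentially"
        using Q(2) B(2) V(2)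
      proof eventually_elim
        case (elim m)
        have "\<bar>sqrt (r m) * z m x * (mean m)\<^sup>2\<bar> = sqrt (r m) * z m x * (mean m)\<^sup>2"
          by (intro abs_of_nonneg mult_nonneg_nonneg z_nonneg) (simp_all add: r_nonneg)
        also have "\<dots> \<le> Q * B * V"
          using Q(1) B(1) by (intro mult_mono elim mult_nonneg_nonneg z_nonneg) (simp_all add: r_nonneg)
        finally show ?case .
      qed
    qed
    then show "(\<lambda>m. H m (A m)) \<longlonglongrightarrow> 0"
    proof (rule Lim_transform_eventually)
      show "eventually (\<lambda>m. (real (n m))\<^sup>2 * tau m (A m) * binomial_weight (n m - 3) (link m (A m)) j - G m x = H m (A m)) sequentially"
        using eventually_ge_at_top[of x] by eventually_elim (simp add: H_def set_seqD[OF A])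
    qed
  next
    show "eventually (\<lambda>m. \<forall>A\<subseteq>{1..m}. \<bar>H m A\<bar> \<le> (V + Q * V) * (1 + (z m (card A))\<^sup>2)) sequentially"
      using Q(2) V(2) ev_ge_1
    proof eventually_elim
      case (elim m)
      show ?case
      proof (intro allI impI)
        fix A assume A: "A \<subseteq> {1..m}"
        let ?x = "card A"
        have nt: "0 \<le> (real (n m))\<^sup>2 * tau m A" by (intro mult_nonneg_nonneg tau_nonneg elim A) simp
        note bb = binomial_weight_bounds[OF link_prob_bounds, of "n m - 3" "s m" m "P m" A j]
        have 1: "0 \<le> (real (n m))\<^sup>2 * tau m A * binomial_weight (n m - 3) (link m A) j"
          by (intro mult_nonneg_nonneg[OF nt] bb)
        have "(real (n m))\<^sup>2 * tau m A * binomial_weight (n m - 3) (link m A) j \<le> (real (n m))\<^sup>2 * tau m A"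
          by (rule mult_left_le[OF bb(2) nt])
        also have "\<dots> \<le> (z m ?x * mean m)\<^sup>2" by (intro tau_le elim A)
        also have "\<dots> = (mean m)\<^sup>2 * (z m ?x)\<^sup>2" by (simp only: power_mult_distrib mult.commute)
        also have "\<dots> \<le> V * (1 + (z m ?x)\<^sup>2)"
          using V(1) elim(2) by (intro mult_mono) auto
        finally have 2: "(real (n m))\<^sup>2 * tau m A * binomial_weight (n m - 3) (link m A) j \<le> V * (1 + (z m ?x)\<^sup>2)" .
        have "G m ?x \<le> sqrt (r m) * (mean m)\<^sup>2 * z m ?x" using G(2)[of m ?x] by (simp only: ac_simps)
        also have "\<dots> \<le> Q * V * (1 + (z m ?x)\<^sup>2)"
          using Q(1) V(1) by (intro mult_mono elim mult_nonneg_nonneg z_nonneg z_le_square) auto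
        finally have 3: "G m ?x \<le> Q * V * (1 + (z m ?x)\<^sup>2)" .
        have "\<bar>H m A\<bar> \<le> V * (1 + (z m ?x)\<^sup>2) + Q * V * (1 + (z m ?x)\<^sup>2)"
          unfolding H_def abs_le_iff using 1 2 3 G(1)[of m ?x] by linarith
        then show "\<bar>H m A\<bar> \<le> (V + Q * V) * (1 + (z m ?x)\<^sup>2)" by (simp only: distrib_right)
      qed
    qed
  qed
  moreover have "eventually (\<lambda>m. measure_pmf.expectation (R m) (H m) =
     (real (n m))\<^sup>2 * measure_pmf.expectation (R m) (\<lambda>A. tau m A * binomial_weight (n m - 3) (link m A) j)
    - sqrt (r m) * mean m * real (Suc j) * E m (\<lambda>x. poisson_weight (Suc j) (z m x * mean m))) sequentially"
    using ev_ge_1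
  proof eventually_elim
    case (elim m)
    note fin = finite_set_random_subset[OF P_range[OF elim]]
    have "measure_pmf.expectation (R m) (H m) =
        measure_pmf.expectation (R m) (\<lambda>A. (real (n m))\<^sup>2 * (tau m A * binomial_weight (n m - 3) (link m A) j))
        - measure_pmf.expectation (R m) (\<lambda>A. G m (card A))"
      unfolding H_def mult.assoc
      by (intro Bochner_Integration.integral_diff integrable_measure_pmf_finite fin)
    also have "measure_pmf.expectation (R m) (\<lambda>A. G m (card A)) = E m (G m)"
      by (rule expectation_random_subset_card[OF P_range[OF elim]])
    also have "G m = (\<lambda>x. sqrt (r m) * mean m * real (Suc j) * poisson_weight (Suc j) (z m x * mean m))"
    proof
      fix x
      have "G m x = sqrt (r m) * mean m * ((z m x * mean m) * poisson_weight j (z m x * mean m))"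
        by (simp only: G_def power2_eq_square ac_simps)
      then show "G m x = sqrt (r m) * mean m * real (Suc j) * poisson_weight (Suc j) (z m x * mean m)"
        by (simp only: poisson_weight_Suc mult.assoc)
    qed
    finally show ?case by (simp only: Bochner_Integration.integral_mult_right_zero)
  qed
  ultimately show ?thesis by (rule Lim_transform_eventually)
qed

text \<open>Both factors \<open>z * mean\<close> are absorbed by the weight, each raising its index.
  The square of the link probability is written as a product so that
  \<open>tendsto_mult_diff_0\<close> can be nested.\<close>

lemma denominator_lim:
  "(\<lambda>m. (real (n m))\<^sup>2 * measure_pmf.expectation (R m) (\<lambda>A. (link m A)\<^sup>2 * binomial_weight (n m - 3) (link m A) j)
    - real (Suc j) * real (Suc (Suc j)) * E m (\<lambda>x. poisson_weight (Suc (Suc j)) (z m x * mean m))) \<longlonglongrightarrow> 0"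
proof -
  define G where "G m x = (z m x * mean m) * (z m x * mean m) * poisson_weight j (z m x * mean m)" for m x
  define H where "H m A = (real (n m) * link m A) * (real (n m) * link m A) * binomial_weight (n m - 3) (link m A) j - G m (card A)" for m A
  obtain V where V: "V > 0" "eventually (\<lambda>m. (mean m)\<^sup>2 \<le> V) sequentially" by (rule mean_square_bounded)
  have zm: "0 \<le> z m x * mean m" for m x by (intro mult_nonneg_nonneg z_nonneg mean_nonneg)
  have nl: "0 \<le> real (n m) * link m A" for m A by (intro mult_nonneg_nonneg link_prob_bounds) simp
  have G: "0 \<le> G m x" "G m x \<le> (z m x * mean m) * (z m x * mean m)" for m x
    unfolding G_def
    by (rule mult_nonneg_nonneg[OF mult_nonneg_nonneg[OF zm zm] poisson_weight_nonneg[OF zm]])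
      (rule mult_left_le[OF poisson_weight_le_1[OF zm] mult_nonneg_nonneg[OF zm zm]])
  have "(\<lambda>m. measure_pmf.expectation (R m) (H m)) \<longlonglongrightarrow> 0"
  proof (rule expectation_random_subset_tendsto_0)
    fix x A assume A: "set_seq x A"
    obtain B where B: "B > 0" "eventually (\<lambda>m. z m x * mean m \<le> B) sequentially" by (rule z_mean_bounded)
    have evz: "eventually (\<lambda>m. \<bar>z m x * mean m\<bar> \<le> B) sequentially"
      using B(2) by eventually_elim (simp only: abs_of_nonneg[OF zm])
    have evl: "eventually (\<lambda>m. \<bar>real (n m) * link m (A m)\<bar> \<le> B) sequentially"
      using B(2) ev_ge_1 eventually_ge_at_top[of x]
    proof eventually_elim
      case (elim m)
      show ?case unfolding abs_of_nonneg[OF nl]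
        using link_le[OF elim(2) set_seqD(1)[OF A elim(3)]] elim(1) unfolding set_seqD(2)[OF A elim(3)]
        by (rule order_trans)
    qed
    have "(\<lambda>m. (real (n m) * link m (A m)) * (real (n m) * link m (A m)) * binomial_weight (n m - 3) (link m (A m)) j - G m x) \<longlonglongrightarrow> 0"
      unfolding G_def
    proof (rule tendsto_mult_diff_0[OF tendsto_mult_diff_0[OF link_lim[OF A] link_lim[OF A] evl evz] binomial_lim[OF A]])
      show "eventually (\<lambda>m. \<bar>binomial_weight (n m - 3) (link m (A m)) j\<bar> \<le> 1) sequentially"
        using binomial_weight_bounds[OF link_prob_bounds] by (intro always_eventually) simp
      show "eventually (\<lambda>m. \<bar>(z m x * mean m) * (z m x * mean m)\<bar> \<le> B * B) sequentially"
        using evz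
      proof eventually_elim
        case (elim m)
        show ?case unfolding abs_mult[of "z m x * mean m" "z m x * mean m"]
          by (rule mult_mono[OF elim elim]) (use B in simp_all)
      qed
    qed
    then show "(\<lambda>m. H m (A m)) \<longlonglongrightarrow> 0"
    proof (rule Lim_transform_eventually)
      show "eventually (\<lambda>m. (real (n m) * link m (A m)) * (real (n m) * link m (A m)) * binomial_weight (n m - 3) (link m (A m)) j - G m x = H m (A m)) sequentially"
        using eventually_ge_at_top[of x] by eventually_elim (simp only: H_def set_seqD[OF A])
    qed
  next
    show "eventually (\<lambda>m. \<forall>A\<subseteq>{1..m}. \<bar>H m A\<bar> \<le> V * (1 + (z m (card A))\<^sup>2)) sequentially"
      using V(2) ev_ge_1
    proof eventually_elim
      case (elim m)
      show ?case
      proof (intro allI impI)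
        fix A assume A: "A \<subseteq> {1..m}"
        let ?x = "card A"
        note bb = binomial_weight_bounds[OF link_prob_bounds, of "n m - 3" "s m" m "P m" A j]
        have nn: "0 \<le> (real (n m) * link m A) * (real (n m) * link m A)" by (intro mult_nonneg_nonneg nl)
        have "(real (n m) * link m A) * (real (n m) * link m A) * binomial_weight (n m - 3) (link m A) j
            \<le> (real (n m) * link m A) * (real (n m) * link m A)"
          by (rule mult_left_le[OF bb(2) nn])
        also have "\<dots> \<le> (z m ?x * mean m) * (z m ?x * mean m)"
          by (intro mult_mono link_le elim A zm nl)
        finally have 1: "(real (n m) * link m A) * (real (n m) * link m A) * binomial_weight (n m - 3) (link m A) j
            \<le> (z m ?x * mean m) * (z m ?x * mean m)" .
        have 2: "0 \<le> (real (n m) * link m A) * (real (n m) * link m A) * binomial_weight (n m - 3) (link m A) j"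
          by (intro mult_nonneg_nonneg[OF nn] bb)
        have "\<bar>H m A\<bar> \<le> (z m ?x * mean m) * (z m ?x * mean m)"
          unfolding H_def abs_le_iff using 1 2 G[of m ?x] by linarith
        also have "\<dots> = (mean m)\<^sup>2 * (z m ?x)\<^sup>2" by (simp only: power2_eq_square ac_simps)
        also have "\<dots> \<le> V * (1 + (z m ?x)\<^sup>2)"
          using V(1) elim(1) by (intro mult_mono) auto
        finally show "\<bar>H m A\<bar> \<le> V * (1 + (z m ?x)\<^sup>2)" .
      qed
    qed
  qed
  moreover have "eventually (\<lambda>m. measure_pmf.expectation (R m) (H m) =
     (real (n m))\<^sup>2 * measure_pmf.expectation (R m) (\<lambda>A. (link m A)\<^sup>2 * binomial_weight (n m - 3) (link m A) j)
    - real (Suc j) * real (Suc (Suc j)) * E m (\<lambda>x. poisson_weight (Suc (Suc j)) (z m x * mean m))) sequentially"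
    using ev_ge_1
  proof eventually_elim
    case (elim m)
    note fin = finite_set_random_subset[OF P_range[OF elim]]
    have "H m = (\<lambda>A. (real (n m))\<^sup>2 * ((link m A)\<^sup>2 * binomial_weight (n m - 3) (link m A) j) - G m (card A))"
      by (rule ext) (simp only: H_def power2_eq_square ac_simps)
    then have "measure_pmf.expectation (R m) (H m) =
        measure_pmf.expectation (R m) (\<lambda>A. (real (n m))\<^sup>2 * ((link m A)\<^sup>2 * binomial_weight (n m - 3) (link m A) j))
        - measure_pmf.expectation (R m) (\<lambda>A. G m (card A))"
      by (simp only:) (intro Bochner_Integration.integral_diff integrable_measure_pmf_finite fin)
    also have "measure_pmf.expectation (R m) (\<lambda>A. G m (card A)) = E m (G m)"
      by (rule expectation_random_subset_card[OF P_range[OF elim]])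
    also have "G m = (\<lambda>x. real (Suc j) * real (Suc (Suc j)) * poisson_weight (Suc (Suc j)) (z m x * mean m))"
    proof
      fix x
      let ?l = "z m x * mean m"
      have "G m x = ?l * (?l * poisson_weight j ?l)"
        by (simp only: G_def mult.assoc)
      also have "\<dots> = real (Suc j) * (?l * poisson_weight (Suc j) ?l)"
        by (subst poisson_weight_Suc[of ?l j]) (rule mult.left_commute)
      finally show "G m x = real (Suc j) * real (Suc (Suc j)) * poisson_weight (Suc (Suc j)) ?l"
        unfolding poisson_weight_Suc[of ?l "Suc j"] by (simp only: mult.assoc)
    qed
    finally show ?case by (simp only: Bochner_Integration.integral_mult_right_zero)
  qed
  ultimately show ?thesis by (rule Lim_transform_eventually)
qed

section \<open>Limits of the mixed Poisson weights\<close>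

lemma mixed_poisson_prob_eq: "mixed_poisson_prob M Z j = (\<integral>\<omega>. poisson_weight j (Z \<omega> * \<mu>) \<partial>M)"
  by (simp add: mixed_poisson_prob_def Let_def \<mu>_def poisson_weight_def)

lemma isCont_poisson_weight: "isCont (poisson_weight j) t"
proof (cases j)
  case 0
  then show ?thesis using DERIV_isCont[OF has_derivative_poisson_weight_0] by simp
next
  case (Suc i)
  then show ?thesis using DERIV_isCont[OF has_derivative_poisson_weight_Suc] by simp
qed

lemma measurable_poisson_weight [measurable]: "poisson_weight j \<in> borel_measurable borel"
  by (intro borel_measurable_continuous_onI continuous_at_imp_continuous_on ballI isCont_poisson_weight)

text \<open>The integrand depends on \<open>m\<close> also through \<open>mean m\<close>, so weak
  convergence is applied with \<mu> instead, and the Lipschitz bound pays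
  \<open>mean m * \<bar>mean m - \<mu>\<bar>\<close> for the exchange.\<close>

lemma poisson_mean_lim:
  "(\<lambda>m. E m (\<lambda>x. poisson_weight j (z m x * mean m))) \<longlonglongrightarrow> mixed_poisson_prob M Z j"
proof -
  \<comment> \<open>A Poisson weight is unbounded for negative arguments; the modulus makes the test
    function bounded and changes nothing where \<open>Z\<close> is nonnegative.\<close>
  let ?f = "\<lambda>t. poisson_weight j (\<bar>t\<bar> * \<mu>)"
  have "(\<lambda>m. E m (\<lambda>x. ?f (z m x))) \<longlonglongrightarrow> (\<integral>\<omega>. ?f (Z \<omega>) \<partial>M)"
  proof (rule weak_tendsto[of ?f 1])
    show "isCont ?f t" for t
      by (rule isCont_o2[OF _ isCont_poisson_weight, where f = "\<lambda>t. \<bar>t\<bar> * \<mu>"])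
        (intro continuous_intros)
    show "\<bar>?f t\<bar> \<le> 1" for t
    proof -
      have t: "0 \<le> \<bar>t\<bar> * \<mu>" using \<mu>_pos by simp
      show ?thesis
        unfolding abs_of_nonneg[OF poisson_weight_nonneg[OF t]] by (rule poisson_weight_le_1[OF t])
    qed
  qed
  moreover have "(\<integral>\<omega>. ?f (Z \<omega>) \<partial>M) = mixed_poisson_prob M Z j"
    unfolding mixed_poisson_prob_eq
  proof (rule integral_cong_AE)
    show "AE \<omega> in M. ?f (Z \<omega>) = poisson_weight j (Z \<omega> * \<mu>)"
      using Z_nonneg by eventually_elim simp
  qed measurable
  ultimately have lim: "(\<lambda>m. E m (\<lambda>x. poisson_weight j (z m x * \<mu>))) \<longlonglongrightarrow> mixed_poisson_prob M Z j"
    by (simp only: abs_of_nonneg[OF z_nonneg])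
  have "(\<lambda>m. E m (\<lambda>x. poisson_weight j (z m x * mean m)) - E m (\<lambda>x. poisson_weight j (z m x * \<mu>))) \<longlonglongrightarrow> 0"
  proof (rule Lim_null_comparison)
    show "eventually (\<lambda>m. norm (E m (\<lambda>x. poisson_weight j (z m x * mean m)) - E m (\<lambda>x. poisson_weight j (z m x * \<mu>)))
        \<le> mean m * \<bar>mean m - \<mu>\<bar>) sequentially"
      using ev_ge_1
    proof eventually_elim
      case (elim m)
      have zm: "0 \<le> z m x * mean m" "0 \<le> z m x * \<mu>" for x
        using \<mu>_pos by (simp_all add: z_nonneg mean_nonneg)
      have eq: "E m (\<lambda>x. poisson_weight j (z m x * mean m)) - E m (\<lambda>x. poisson_weight j (z m x * \<mu>)) =
          E m (\<lambda>x. poisson_weight j (z m x * mean m) - poisson_weight j (z m x * \<mu>))"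
        by (intro Bochner_Integration.integral_diff[symmetric] integrable_P elim)
      have "\<bar>E m (\<lambda>x. poisson_weight j (z m x * mean m)) - E m (\<lambda>x. poisson_weight j (z m x * \<mu>))\<bar>
          \<le> E m (\<lambda>x. \<bar>poisson_weight j (z m x * mean m) - poisson_weight j (z m x * \<mu>)\<bar>)"
        unfolding eq by (rule integral_abs_bound)
      also have "\<dots> \<le> E m (\<lambda>x. z m x * \<bar>mean m - \<mu>\<bar>)"
      proof (rule expectation_P_mono[OF elim])
        fix x
        have "\<bar>poisson_weight j (z m x * mean m) - poisson_weight j (z m x * \<mu>)\<bar> \<le> \<bar>z m x * mean m - z m x * \<mu>\<bar>"
          by (rule poisson_weight_lipschitz[OF zm])
        also have "\<dots> = z m x * \<bar>mean m - \<mu>\<bar>"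
          by (simp only: right_diff_distrib[symmetric] abs_mult abs_of_nonneg[OF z_nonneg])
        finally show "\<bar>poisson_weight j (z m x * mean m) - poisson_weight j (z m x * \<mu>)\<bar> \<le> z m x * \<bar>mean m - \<mu>\<bar>" .
      qed
      also have "\<dots> = mean m * \<bar>mean m - \<mu>\<bar>" unfolding mean_def by simp
      finally show ?case unfolding real_norm_def .
    qed
    have "(\<lambda>m. mean m * \<bar>mean m - \<mu>\<bar>) \<longlonglongrightarrow> \<mu> * \<bar>\<mu> - \<mu>\<bar>"
      by (intro tendsto_mult tendsto_rabs tendsto_diff tendsto_const mean_lim)
    then show "(\<lambda>m. mean m * \<bar>mean m - \<mu>\<bar>) \<longlonglongrightarrow> 0" by simp
  qed
  from tendsto_add[OF this lim] show ?thesis by simp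
qed

text \<open>A weight vanishes at most at parameter 0, so a zero integral would force
  \<open>Z = 0\<close> almost surely, against \<open>\<mu> > 0\<close>. This makes the limit of the
  denominator nonzero.\<close>

lemma mixed_poisson_prob_pos: "0 < mixed_poisson_prob M Z j"
proof -
  let ?g = "\<lambda>\<omega>. poisson_weight j (\<bar>Z \<omega>\<bar> * \<mu>)"
  have meas: "?g \<in> borel_measurable M" by measurable
  have nonneg: "0 \<le> ?g \<omega>" for \<omega> using \<mu>_pos by (intro poisson_weight_nonneg) simp
  have int: "integrable M ?g"
  proof (rule M.integrable_const_bound[of _ 1])
    have "norm (?g \<omega>) \<le> 1" for \<omega>
      using nonneg[of \<omega>] poisson_weight_le_1[of "\<bar>Z \<omega>\<bar> * \<mu>" j] \<mu>_pos by simp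
    then show "AE \<omega> in M. norm (?g \<omega>) \<le> 1" by simp
  qed (rule meas)
  have eq: "mixed_poisson_prob M Z j = (\<integral>\<omega>. ?g \<omega> \<partial>M)"
    unfolding mixed_poisson_prob_eq
  proof (rule integral_cong_AE)
    show "AE \<omega> in M. poisson_weight j (Z \<omega> * \<mu>) = ?g \<omega>"
      using Z_nonneg by eventually_elim simp
  qed measurable
  have "(\<integral>\<omega>. ?g \<omega> \<partial>M) \<noteq> 0"
  proof
    assume "(\<integral>\<omega>. ?g \<omega> \<partial>M) = 0"
    then have "AE \<omega> in M. ?g \<omega> = 0"
      using integral_nonneg_eq_0_iff_AE[OF int AE_I2[OF nonneg]] by blast
    then have "AE \<omega> in M. Z \<omega> = 0"
    proof eventually_elim
      case (elim \<omega>)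
      then have "(\<bar>Z \<omega>\<bar> * \<mu>) ^ j = 0" unfolding poisson_weight_def by simp
      then have "\<bar>Z \<omega>\<bar> * \<mu> = 0" by (simp only: power_eq_0_iff)
      then show ?case using \<mu>_pos by simp
    qed
    then have "\<mu> = (\<integral>\<omega>. 0 \<partial>M)"
      unfolding \<mu>_def by (intro integral_cong_AE) auto
    with \<mu>_pos show False by simp
  qed
  moreover have "0 \<le> (\<integral>\<omega>. ?g \<omega> \<partial>M)" by (intro Bochner_Integration.integral_nonneg nonneg)
  ultimately show ?thesis unfolding eq by simp
qed

text \<open>Two prescribed edges at vertex 1 have probability of order \<open>1 / n^2\<close>, so
  both expectations are scaled by \<open>n^2\<close>, which cancels. In the quotient of the limits
  \<open>Suc j = k - 1\<close> cancels too, and the surviving factor \<open>k\<close> of the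
  denominator gives \<open>1 / k\<close>.\<close>

lemma clustering_coeff_lim:
  assumes k: "k \<ge> 2"
  shows "(\<lambda>m. clustering_coeff (s m) (n m) m (P m) k) \<longlonglongrightarrow>
    1 / real k * (\<mu> / sqrt \<beta>) * (mixed_poisson_prob M Z (k - 1) / mixed_poisson_prob M Z k)"
proof -
  define j where "j = k - 2"
  have kj: "k = Suc (Suc j)" using k by (simp add: j_def)
  define num where "num m = measure_pmf.expectation (R m) (\<lambda>A. tau m A * binomial_weight (n m - 3) (link m A) j)" for m
  define den where "den m = measure_pmf.expectation (R m) (\<lambda>A. (link m A)\<^sup>2 * binomial_weight (n m - 3) (link m A) j)" for m
  let ?p = "mixed_poisson_prob M Z"
  have "(\<lambda>m. sqrt (r m) * mean m * real (Suc j) * E m (\<lambda>x. poisson_weight (Suc j) (z m x * mean m)))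
     \<longlonglongrightarrow> 1 / sqrt \<beta> * \<mu> * real (Suc j) * ?p (Suc j)"
    by (intro tendsto_mult sqrt_r_lim mean_lim tendsto_const poisson_mean_lim)
  from tendsto_add[OF numerator_lim[of j] this]
  have num: "(\<lambda>m. (real (n m))\<^sup>2 * num m) \<longlonglongrightarrow> 1 / sqrt \<beta> * \<mu> * real (Suc j) * ?p (Suc j)"
    unfolding num_def by (simp del: of_nat_Suc)
  have "(\<lambda>m. real (Suc j) * real (Suc (Suc j)) * E m (\<lambda>x. poisson_weight (Suc (Suc j)) (z m x * mean m)))
     \<longlonglongrightarrow> real (Suc j) * real (Suc (Suc j)) * ?p (Suc (Suc j))"
    by (intro tendsto_mult tendsto_const poisson_mean_lim)
  from tendsto_add[OF denominator_lim[of j] this]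
  have den: "(\<lambda>m. (real (n m))\<^sup>2 * den m) \<longlonglongrightarrow> real (Suc j) * real (Suc (Suc j)) * ?p (Suc (Suc j))"
    unfolding den_def by (simp del: of_nat_Suc)
  have pos: "real (Suc j) > 0" "real (Suc (Suc j)) > 0" "?p (Suc (Suc j)) > 0"
    using mixed_poisson_prob_pos by simp_all
  have "(\<lambda>m. ((real (n m))\<^sup>2 * num m) / ((real (n m))\<^sup>2 * den m)) \<longlonglongrightarrow>
      (1 / sqrt \<beta> * \<mu> * real (Suc j) * ?p (Suc j)) / (real (Suc j) * real (Suc (Suc j)) * ?p (Suc (Suc j)))"
    by (intro tendsto_divide num den) (use pos in auto)
  also have "(1 / sqrt \<beta> * \<mu> * real (Suc j) * ?p (Suc j)) / (real (Suc j) * real (Suc (Suc j)) * ?p (Suc (Suc j)))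
      = 1 / real k * (\<mu> / sqrt \<beta>) * (?p (k - 1) / ?p k)"
    unfolding kj using pos by (simp del: of_nat_Suc)
  finally have lim: "(\<lambda>m. ((real (n m))\<^sup>2 * num m) / ((real (n m))\<^sup>2 * den m)) \<longlonglongrightarrow>
      1 / real k * (\<mu> / sqrt \<beta>) * (?p (k - 1) / ?p k)" .
  have n3: "eventually (\<lambda>m. 3 \<le> n m) sequentially"
    using n_at_top unfolding filterlim_at_top by blast
  show ?thesis
  proof (rule Lim_transform_eventually[OF lim])
    show "eventually (\<lambda>m. (real (n m))\<^sup>2 * num m / ((real (n m))\<^sup>2 * den m) = clustering_coeff (s m) (n m) m (P m) k) sequentially"
      using n3 ev_ge_1
    proof eventually_elim
      case (elim m)
      have "clustering_coeff (s m) (n m) m (P m) k = num m / den m"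
        unfolding num_def den_def tau_def j_def by (rule clustering_coeff_eq[OF P_range[OF elim(2)] elim(1) k])
      moreover have "(real (n m))\<^sup>2 \<noteq> 0" using elim(1) by simp
      ultimately show ?case by simp
    qed
  qed
qed

end

theorem theorem2p4:
  fixes \<beta> :: real
    and n s :: "nat \<Rightarrow> nat"
    and P :: "nat \<Rightarrow> nat pmf"
    and M :: "'a measure"
    and Z :: "'a \<Rightarrow> real"
  assumes "\<beta> > 0"
    and "\<And>m. m \<ge> 1 \<Longrightarrow> 1 \<le> s m \<and> s m \<le> m"
    and "\<And>m. m \<ge> 1 \<Longrightarrow> set_pmf (P m) \<subseteq> {0..m}"
    and "(\<lambda>m. real (s m)) \<in> O(\<lambda>_. 1)"
    and "(\<lambda>m. real (m choose s m) / real (n m)) \<longlonglongrightarrow> \<beta>"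
    and "prob_space M"
    and "Z \<in> borel_measurable M"
    and "weak_conv_m (\<lambda>m. distr (measure_pmf (P m)) borel (Z_scaled (s m) (n m) m))
           (distr M borel Z)"
    and "integrable M (\<lambda>\<omega>. (Z \<omega>)\<^sup>2)"
    and "0 < (\<integral>\<omega>. (Z \<omega>)\<^sup>2 \<partial>M)"
    and "(\<lambda>m. \<integral>x. (Z_scaled (s m) (n m) m x)\<^sup>2 \<partial>measure_pmf (P m))
           \<longlonglongrightarrow> (\<integral>\<omega>. (Z \<omega>)\<^sup>2 \<partial>M)"
  shows "\<forall>k\<ge>2.
    (\<lambda>m. clustering_coeff (s m) (n m) m (P m) k
         - 1 / real k * ((\<integral>\<omega>. Z \<omega> \<partial>M) / sqrt \<beta>)
           * (mixed_poisson_prob M Z (k - 1) / mixed_poisson_prob M Z k))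
    \<in> o(\<lambda>_. 1)"
proof (intro allI impI)
  interpret intersection_graph_seq \<beta> n s P M Z
    by (intro intersection_graph_seq.intro assms)
  fix k :: nat assume "2 \<le> k"
  from LIM_zero[OF clustering_coeff_lim[OF this]]
  show "(\<lambda>m. clustering_coeff (s m) (n m) m (P m) k
         - 1 / real k * ((\<integral>\<omega>. Z \<omega> \<partial>M) / sqrt \<beta>)
           * (mixed_poisson_prob M Z (k - 1) / mixed_poisson_prob M Z k)) \<in> o(\<lambda>_. 1)"
    unfolding \<mu>_def by (intro smalloI_tendsto) simp_all
qed

end
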